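(* Let $\tau$ be the Archimedean tessellation of type $(3^3.4^2)$, and let $\tau_{\mathbf a,\mathbf b}=\tau/\langle\mathbf a,\mathbf b\rangle$ be the toroidal map given by the translation subgroup $\langle\mathbf a,\mathbf b\rangle\le T_\tau$ generated by $\mathbf a=(a_1,a_2)$ and $\mathbf b=(b_1,b_2)$ (integer coordinates with respect to the basis $(\mathbf e_1,\mathbf e_2)$ of $T_\tau$) with $\Delta:=a_1b_2-a_2b_1\ne0$. Put $$g_1=\gcd(a_2,b_2),\quad g_2=\gcd(2a_1+a_2,\,2b_1+b_2),\quad c=\frac{\Delta}{g_1},\quad d_1=-\frac{\Delta}{2}\left(\frac1{g_1}+\frac1{g_2}\right),\quad d_2=-\frac{\Delta}{g_2}.$$ Then $\tau_{\mathbf a,\mathbf b}$ has a unique minimal almost regular cover $\tau_{\mathbf u,\mathbf v}=\tau/\langle\mathbf u,\mathbf v\rangle$, and it is given by the subgroup $$\langle\mathbf u,\mathbf v\rangle=\begin{cases}\langle(c,0),\,(-d_1,\,c+2d_1)\rangle, & \text{if } \dfrac{a_2}{g_1}-\dfrac{2a_1+a_2}{g_2}\text{ and }\dfrac{b_2}{g_1}-\dfrac{2b_1+b_2}{g_2}\text{ are both even},\\[2mm] \langle(c,0),\,(-d_2,\,2d_2)\rangle, & \text{otherwise.}\end{cases}$$ Moreover, the number $K_{\min}$ of fundamental regions of $\tau_{\mathbf a,\mathbf b}$ glued together in order to obtain a fundamental region of $\tau_{\mathbf u,\mathbf v}$ is $$K_{\min}=\begin{cases}\left|\dfrac{\Delta}{g_1g_2}\right|,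 & \text{if } \dfrac{a_2}{g_1}-\dfrac{2a_1+a_2}{g_2}\text{ and }\dfrac{b_2}{g_1}-\dfrac{2b_1+b_2}{g_2}\text{ are both even},\\[2mm] 2\left|\dfrac{\Delta}{g_1g_2}\right|, & \text{otherwise.}\end{cases}$$
   Context: The Archimedean tessellation $\tau$ of type $(3^3.4^2)$ is the vertex-transitive edge-to-edge tessellation of the Euclidean plane by regular polygons with three consecutive triangles and two consecutive squares around each vertex; it consists of alternating horizontal strips of squares and of triangles. $\mathrm{Aut}(\tau)$ is the group of isometries preserving $\tau$ and $T_\tau$ is its subgroup of all translations. $T_\tau$ is generated by a positively oriented pair $(\mathbf e_1,\mathbf e_2)$ of shortest non-parallel translations, where $\mathbf e_1$ is parallel to the strips and $\mathbf e_2$ is chosen so that its component along the strips is $\tfrac12\mathbf e_1$; with edge length 1 and horizontal strips, $\mathbf e_1=(1,0)$, $\mathbf e_2=(1/2,\,1+\sqrt3/2)$ in Cartesian coordinates. Coordinate pairs $(x,y)$ of translations mean $x\mathbf e_1+y\mathbf e_2$. A toroidal map of this type is a quotient $\tau/G$, where $G\le T_\tau$ is generated by two linearly independent translations; its fundamental region is the parallelogram spanned by a pair of generators of $G$. A flag of $\tau$ is a triple of an incident vertex, edge and face; a flag of $\tau/G$ is a $G$-orbit of flags of $\tau$. $\mathrm{Aut}(\tau/G)\cong \mathrm{Norm}_{\mathrm{Aut}(\tau)}(G)/G$ is the group induced by the normalizer of $G$ in $\mathrm{Aut}(\tau)$. $\tau/G$ is almost regular if its number of flag orbits under $\mathrm{Aut}(\tau/G)$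 equals the number of flag orbits of $\tau$ under $\mathrm{Aut}(\tau)$. $\tau/H$ is a cover of $\tau/G$ if $H\le G$; toroidal maps are ordered by $\mathcal M\le\mathcal N$ iff $\mathcal N$ covers $\mathcal M$. A minimal almost regular cover of $\mathcal M$ is a minimal element of the set of almost regular toroidal maps covering $\mathcal M$. When $\tau/H$ covers $\tau/G$, the number of fundamental regions of $\tau/G$ glued together to obtain a fundamental region of $\tau/H$ equals the index $[G:H]$. The gcd's are positive. *)

theory Defs
  imports "HOL-Analysis.Analysis" "HOL-Algebra.Generated_Groups" "HOL-Algebra.Group_Action"
begin

type_synonym plane = "real ^ 2"

text \<open>The tessellation of type (3^3.4^2) with edge length 1 and horizontal strips. Within one vertical period there is a strip of squares
  of height 1 below a strip of triangles of height \<open>sqrt 3 / 2\<close>; \<open>up\<close> is the vertical side of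
  the squares.\<close>

definition e1 :: plane where "e1 = vector [1, 0]"
definition e2 :: plane where "e2 = vector [1 / 2, 1 + sqrt 3 / 2]"
definition up :: plane where "up = vector [0, 1]"

definition tvec :: "real \<Rightarrow> real \<Rightarrow> plane" where
  "tvec x y = x *\<^sub>R e1 + y *\<^sub>R e2"

definition square_at :: "plane \<Rightarrow> plane set" where
  "square_at p = convex hull {p, p + e1, p + e1 + up, p + up}"

definition up_triangle_at :: "plane \<Rightarrow> plane set" where
  "up_triangle_at p = convex hull {p + up, p + up + e1, p + e2}"

definition down_triangle_at :: "plane \<Rightarrow> plane set" where
  "down_triangle_at p = convex hull {p + up + e1, p + e2, p + e2 + e1}"

text \<open>The tessellation is represented by its set of faces; its edges and vertices are the
  edges and vertices of these polygons.\<close>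

definition tau :: "plane set set" where
  "tau = (\<Union>m::int. \<Union>n::int. let p = tvec (of_int m) (of_int n)
            in {square_at p, up_triangle_at p, down_triangle_at p})"

text \<open>Since the tessellation is edge-to-edge, an edge is incident with a face iff it is an
  edge of that polygon. The extreme points of an edge are its two end points.\<close>

definition flags :: "(plane \<times> plane set \<times> plane set) set" where
  "flags = {(v, e, f). f \<in> tau \<and> e edge_of f \<and> v extreme_point_of e}"

definition Aut_tau :: "(plane \<Rightarrow> plane) monoid" where
  "Aut_tau = \<lparr>carrier = {g. surj g \<and> (\<forall>x y. dist (g x) (g y) = dist x y) \<and> (\<lambda>f. g ` f) ` tau = tau},
              mult = (\<circ>), one = id\<rparr>"

lemma group_Aut_tau: "group Aut_tau"
proof (rule groupI)
  fix g assume g: "g \<in> carrier Aut_tau"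
  then have s: "surj g" and d: "\<And>x y. dist (g x) (g y) = dist x y" and t: "(\<lambda>f. g ` f) ` tau = tau"
    by (auto simp: Aut_tau_def)
  have i: "inj g" by (rule injI) (metis d dist_eq_0_iff)
  define h where "h = inv_into UNIV g"
  have hg: "h \<circ> g = id" using i by (simp add: h_def)
  have gh: "g (h x) = x" for x using s by (simp add: h_def surj_f_inv_f)
  have "(\<lambda>f. h ` f) ` tau = (\<lambda>f. h ` f) ` ((\<lambda>f. g ` f) ` tau)" by (simp only: t)
  also have "\<dots> = (\<lambda>f. (h \<circ> g) ` f) ` tau" by (simp add: image_image)
  also have "\<dots> = tau" by (simp add: hg)
  finally have "(\<lambda>f. h ` f) ` tau = tau" .
  moreover have "surj h" using i by (simp add: h_def inj_imp_surj_inv)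
  moreover have "dist (h x) (h y) = dist x y" for x y using d[of "h x" "h y"] by (simp add: gh)
  ultimately have "h \<in> carrier Aut_tau" by (simp add: Aut_tau_def)
  with hg show "\<exists>h\<in>carrier Aut_tau. h \<otimes>\<^bsub>Aut_tau\<^esub> g = \<one>\<^bsub>Aut_tau\<^esub>"
    by (auto simp: Aut_tau_def)
next
  fix g h assume g: "g \<in> carrier Aut_tau" and h: "h \<in> carrier Aut_tau"
  have "(\<lambda>f. (g \<circ> h) ` f) ` tau = (\<lambda>f. g ` f) ` ((\<lambda>f. h ` f) ` tau)"
    by (simp add: image_image)
  also have "\<dots> = tau" using g h by (simp add: Aut_tau_def)
  finally have "(\<lambda>f. (g \<circ> h) ` f) ` tau = tau" .
  moreover have "surj (g \<circ> h)" using g h by (intro comp_surj) (simp_all add: Aut_tau_def)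
  moreover have "dist ((g \<circ> h) x) ((g \<circ> h) y) = dist x y" for x y
    using g h by (simp add: Aut_tau_def)
  ultimately show "g \<otimes>\<^bsub>Aut_tau\<^esub> h \<in> carrier Aut_tau" by (simp add: Aut_tau_def)
qed (simp_all add: Aut_tau_def comp_assoc)

definition T_tau :: "(plane \<Rightarrow> plane) set" where
  "T_tau = {g \<in> carrier Aut_tau. \<exists>t. g = (+) t}"

definition flag_act :: "(plane \<Rightarrow> plane) \<Rightarrow> plane \<times> plane set \<times> plane set \<Rightarrow> plane \<times> plane set \<times> plane set" where
  "flag_act g = (\<lambda>(v, e, f)\<in>flags. (g v, g ` e, g ` f))"

text \<open>The toroidal map \<open>tau / G\<close> is represented by the group \<open>G\<close> of translations.\<close>

definition trans_group :: "plane \<Rightarrow> plane \<Rightarrow> (plane \<Rightarrow> plane) set" where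
  "trans_group s t = generate Aut_tau {(+) s, (+) t}"

definition toroidal :: "(plane \<Rightarrow> plane) set \<Rightarrow> bool" where
  "toroidal G \<longleftrightarrow> (\<exists>s t. (+) s \<in> T_tau \<and> (+) t \<in> T_tau \<and> s \<noteq> t \<and> independent {s, t} \<and> G = trans_group s t)"

definition map_flags :: "(plane \<Rightarrow> plane) set \<Rightarrow> (plane \<times> plane set \<times> plane set) set set" where
  "map_flags G = orbits (Aut_tau\<lparr>carrier := G\<rparr>) flags flag_act"

definition Aut_map :: "(plane \<Rightarrow> plane) set \<Rightarrow> (plane \<Rightarrow> plane) set monoid" where
  "Aut_map G = (Aut_tau\<lparr>carrier := normalizer Aut_tau G\<rparr>) Mod G"

text \<open>An element of \<open>Aut_map G\<close> is a coset \<open>C\<close> of \<open>G\<close>, and all members of \<open>C\<close> send a given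
  \<open>G\<close>-orbit \<open>Y\<close> of flags to the same \<open>G\<close>-orbit.\<close>

definition map_act :: "(plane \<Rightarrow> plane) set \<Rightarrow> (plane \<Rightarrow> plane) set
    \<Rightarrow> (plane \<times> plane set \<times> plane set) set \<Rightarrow> (plane \<times> plane set \<times> plane set) set" where
  "map_act G C = (\<lambda>Y\<in>map_flags G. (\<Union>g\<in>C. flag_act g ` Y))"

definition almost_regular :: "(plane \<Rightarrow> plane) set \<Rightarrow> bool" where
  "almost_regular G \<longleftrightarrow>
     card (orbits (Aut_map G) (map_flags G) (map_act G)) = card (orbits Aut_tau flags flag_act)"

definition covers :: "(plane \<Rightarrow> plane) set \<Rightarrow> (plane \<Rightarrow> plane) set \<Rightarrow> bool" where
  "covers H G \<longleftrightarrow> toroidal H \<and> toroidal G \<and> subgroup H (Aut_tau\<lparr>carrier := G\<rparr>)"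

definition almost_regular_covers :: "(plane \<Rightarrow> plane) set \<Rightarrow> (plane \<Rightarrow> plane) set set" where
  "almost_regular_covers G = {H. covers H G \<and> almost_regular H}"

text \<open>Minimality refers to the order on maps, in which \<open>tau / H'\<close> lies below \<open>tau / H\<close> iff
  \<open>tau / H\<close> covers \<open>tau / H'\<close>.\<close>

definition minimal_almost_regular_cover :: "(plane \<Rightarrow> plane) set \<Rightarrow> (plane \<Rightarrow> plane) set \<Rightarrow> bool" where
  "minimal_almost_regular_cover G H \<longleftrightarrow>
     H \<in> almost_regular_covers G \<and> (\<forall>H'\<in>almost_regular_covers G. covers H H' \<longrightarrow> H' = H)"

text \<open>The number of fundamental regions of \<open>tau / G\<close> making up one of \<open>tau / H\<close>, i.e. the
  index of \<open>H\<close> in \<open>G\<close>.\<close>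

definition num_regions :: "(plane \<Rightarrow> plane) set \<Rightarrow> (plane \<Rightarrow> plane) set \<Rightarrow> nat" where
  "num_regions G H = card (rcosets\<^bsub>Aut_tau\<lparr>carrier := G\<rparr>\<^esub> H)"

end

theory Submission
  imports Defs "HOL-Algebra.Zassenhaus"
begin

text \<open>The theorem rests on one geometric fact. Every symmetry of the tessellation has one of four
  linear parts: the identity, the point reflection, the reflection \<open>flip\<close> in a vertical
  line, or the reflection in a horizontal line (\<open>Aut_linear_part\<close>). Conjugation by a
  symmetry acts on translation vectors through its linear part, so the normalizer of a
  translation group contains all translations and point reflections. The number of flag
  orbits of \<open>\<tau>/H\<close> is the number of orbits of the normalizer of \<open>H\<close> on the flags of
  \<open>\<tau>\<close>; since these numbers are finite and some flag has a trivial stabilizer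
  (\<open>base_flag_stabilizer\<close>), \<open>\<tau>/H\<close> is almost regular exactly if the normalizer is the
  whole group, that is, if the lattice of \<open>H\<close> is invariant under \<open>flip\<close>
  (\<open>almost_regular_iff_flip_invariant\<close>).

  Consequently the lattice \<open>\<Lambda>\<close> of \<open>G\<close> has a largest sublattice belonging to an
  almost regular map, the intersection of \<open>\<Lambda>\<close> with its mirror image, and it gives
  the least almost regular cover (\<open>minimal_cover_unique\<close>). It remains to compute it. With
  respect to the basis \<open>(a, b)\<close> write \<open>m a + n b\<close> as \<open>(m, n)\<close>. Up to constant factors its
  height is \<open>m q + n p\<close> and its abscissa \<open>m t + n r\<close>, where \<open>(p, q)\<close> and \<open>(r, t)\<close> are the
  coprime pairs obtained from \<open>(b2, a2)\<close> and \<open>(2 b1 + b2, 2 a1 + a2)\<close> by dividing by \<open>g1\<close>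
  and \<open>g2\<close>. Put \<open>D = t p - q r\<close>, which is \<open>2 \<Delta> / (g1 g2)\<close>. A vector of \<open>\<Lambda>\<close>
  has its mirror image in \<open>\<Lambda>\<close> if and only if \<open>D\<close> divides twice its scaled height
  (\<open>reflected_iff_dvd\<close>). Hence the sublattice consists of the vectors whose scaled height is
  a multiple of \<open>N\<close>, where \<open>N = D / 2\<close> or \<open>N = D\<close> according to the parity of \<open>D\<close>. Its index
  is \<open>\<bar>N\<bar>\<close> (\<open>num_regions_height\<close>), generators are read off in
  \<open>sublattice_generators\<close>, and \<open>D\<close> is even precisely if \<open>q - t\<close> and \<open>p - r\<close> are
  (\<open>even_det_iff\<close>), which is the case distinction of the theorem.\<close>

section \<open>Coordinates and the symmetries of the tessellation\<close>

definition flip :: "plane \<Rightarrow> plane" where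
  "flip v = vector [- v$1, v$2]"

lemma plane_eq_iff: "v = w \<longleftrightarrow> v$1 = w$1 \<and> v$2 = w$2" for v w :: plane
  by (simp add: vec_eq_iff forall_2)

lemma norm_plane: "norm v = sqrt ((v$1)\<^sup>2 + (v$2)\<^sup>2)" for v :: plane
  by (simp add: norm_vec_def L2_set_def sum_2)

lemma basis_nth [simp]:
  "e1$1 = 1" "e1$2 = 0" "e2$1 = 1/2" "e2$2 = 1 + sqrt 3 / 2" "up$1 = 0" "up$2 = 1"
  by (simp_all add: e1_def e2_def up_def)

lemma flip_nth [simp]: "flip v $ 1 = - v$1" "flip v $ 2 = v$2"
  by (simp_all add: flip_def)

lemma tvec_nth: "tvec x y $ 1 = x + y / 2" "tvec x y $ 2 = y * (1 + sqrt 3 / 2)"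
  by (simp_all add: tvec_def)

lemma tvec_add: "tvec x y + tvec x' y' = tvec (x + x') (y + y')"
  by (simp add: tvec_def algebra_simps)

lemma flip_flip [simp]: "flip (flip v) = v" "flip \<circ> flip = id"
  by (simp_all add: plane_eq_iff fun_eq_iff)

lemma linear_flip: "linear flip"
  by (rule linearI) (simp_all add: plane_eq_iff)

lemma norm_flip [simp]: "norm (flip v) = norm v"
  by (simp add: norm_plane)

lemma flip_e [simp]: "flip e1 = - e1" "flip e2 = e2 - e1" "flip up = up"
  by (simp_all add: plane_eq_iff)

text \<open>The faces lying in one cell of the tessellation. Grouping them by cells makes both the
  action of the translations and the finiteness of the number of faces up to translation
  immediate.\<close>

definition faces_at :: "plane \<Rightarrow> plane set set" where
  "faces_at p = {square_at p, up_triangle_at p, down_triangle_at p}"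

lemma tau_eq: "tau = (\<Union>m::int. \<Union>n::int. faces_at (tvec (of_int m) (of_int n)))"
  by (simp add: tau_def faces_at_def Let_def)

lemma faces_at_translation:
  "(\<lambda>f. (+) t ` f) ` faces_at p = faces_at (t + p)"
  by (simp add: faces_at_def square_at_def up_triangle_at_def down_triangle_at_def
      flip: convex_hull_translation) (simp add: add.assoc)

text \<open>Every element of this set translates the tessellation to itself, so the set indexes the
  cells of the tessellation.\<close>

definition periods :: "plane set" where
  "periods = {tvec (of_int m) (of_int n) | m n :: int. True}"

lemma periods_add: "s \<in> periods \<Longrightarrow> t \<in> periods \<Longrightarrow> s + t \<in> periods"
  unfolding periods_def using tvec_add by clarsimp (metis of_int_add)

lemma periods_uminus: "t \<in> periods \<Longrightarrow> - t \<in> periods"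
proof -
  assume "t \<in> periods"
  then obtain m n :: int where "t = tvec (of_int m) (of_int n)" by (auto simp: periods_def)
  then have "- t = tvec (of_int (- m)) (of_int (- n))" by (simp add: tvec_def)
  then show ?thesis unfolding periods_def by blast
qed

lemma tau_periods: "tau = (\<Union>p\<in>periods. faces_at p)"
  by (auto simp: tau_eq periods_def)

text \<open>A map and its inverse that both send faces to faces permute the faces; this spares a
  separate surjectivity argument for every symmetry.\<close>

lemma AutI:
  assumes "g \<circ> h = id" "\<And>x y. dist (g x) (g y) = dist x y"
    and "\<And>f. f \<in> tau \<Longrightarrow> g ` f \<in> tau" "\<And>f. f \<in> tau \<Longrightarrow> h ` f \<in> tau"
  shows "g \<in> carrier Aut_tau"
proof -
  have gh: "g (h x) = x" for x using assms(1) by (simp add: fun_eq_iff)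
  have "tau \<subseteq> (\<lambda>f. g ` f) ` tau"
  proof
    fix f assume "f \<in> tau"
    then have "h ` f \<in> tau" "f = g ` (h ` f)" using assms(4) by (simp_all add: image_image gh)
    then show "f \<in> (\<lambda>f. g ` f) ` tau" by blast
  qed
  moreover have "surj g" using gh by (metis surjI)
  ultimately show ?thesis using assms by (auto simp: Aut_tau_def)
qed

lemma translation_Aut: assumes "t \<in> periods" shows "(+) t \<in> carrier Aut_tau"
proof (rule AutI[where h = "(+) (- t)"])
  have *: "(+) t ` f \<in> tau" if "f \<in> tau" "t \<in> periods" for f t
  proof -
    from that obtain p where "p \<in> periods" "f \<in> faces_at p" by (auto simp: tau_periods)
    then have "(+) t ` f \<in> faces_at (t + p)" "t + p \<in> periods"
      using that(2) by (auto simp flip: faces_at_translation simp: periods_add)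
    then show ?thesis by (auto simp: tau_periods)
  qed
  show "(+) t ` f \<in> tau" if "f \<in> tau" for f using * that assms by blast
  show "(+) (- t) ` f \<in> tau" if "f \<in> tau" for f using * that assms periods_uminus by blast
qed (auto simp: fun_eq_iff)

text \<open>The reflection turns left ends of horizontal edges into right ends. The definitions of the
  faces start from left ends, so the anchor of the image moves one edge to the left; the
  lower vertex of a down triangle is attached to the cell by its right end, which costs one
  more edge.\<close>

lemma flip_face:
  "flip ` square_at p = square_at (flip p - e1)"
  "flip ` up_triangle_at p = up_triangle_at (flip p - e1)"
  "flip ` down_triangle_at p = down_triangle_at (flip p - e1 - e1)"
proof -
  have add: "flip (x + y) = flip x + flip y" for x y by (simp add: linear_add[OF linear_flip])
  show "flip ` square_at p = square_at (flip p - e1)"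
    unfolding square_at_def
    by (simp add: convex_hull_linear_image[OF linear_flip] add)
      (rule arg_cong[where f = "\<lambda>S. convex hull S"], auto)
  show "flip ` up_triangle_at p = up_triangle_at (flip p - e1)"
    unfolding up_triangle_at_def
    by (simp add: convex_hull_linear_image[OF linear_flip] add)
      (rule arg_cong[where f = "\<lambda>S. convex hull S"], auto simp: algebra_simps)
  show "flip ` down_triangle_at p = down_triangle_at (flip p - e1 - e1)"
    unfolding down_triangle_at_def
    by (simp add: convex_hull_linear_image[OF linear_flip] add)
      (rule arg_cong[where f = "\<lambda>S. convex hull S"], auto simp: algebra_simps)
qed

lemma flip_tvec: "flip (tvec x y) = tvec (- x - y) y"
  by (simp add: plane_eq_iff tvec_nth)

lemma flip_Aut: "flip \<in> carrier Aut_tau"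
proof -
  have e1: "- e1 \<in> periods"
  proof -
    have "- e1 = tvec (of_int (- 1)) (of_int 0)" by (simp add: tvec_def)
    then show ?thesis unfolding periods_def by blast
  qed
  have *: "flip ` f \<in> tau" if "f \<in> tau" for f
  proof -
    from that obtain p where p: "p \<in> periods" "f \<in> faces_at p" by (auto simp: tau_periods)
    from p(1) obtain m n :: int where "p = tvec (of_int m) (of_int n)" by (auto simp: periods_def)
    then have "flip p = tvec (of_int (- m - n)) (of_int n)" by (simp add: flip_tvec)
    then have "flip p \<in> periods" unfolding periods_def by blast
    then have "flip p - e1 \<in> periods" "flip p - e1 - e1 \<in> periods"
      using periods_add[OF _ e1, of "flip p"] periods_add[OF _ e1, of "flip p - e1"] by simp_all
    then show ?thesis using p(2) by (auto simp: tau_periods faces_at_def flip_face)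
  qed
  show ?thesis
  proof (rule AutI[where h = flip])
    show "dist (flip x) (flip y) = dist x y" for x y
      by (simp add: dist_norm linear_diff[OF linear_flip, symmetric])
  qed (use * in auto)
qed

lemma convex_hull_nth_bounds:
  fixes S :: "plane set"
  assumes "x \<in> convex hull S" and "\<And>s. s \<in> S \<Longrightarrow> l \<le> s $ i \<and> s $ i \<le> u"
  shows "l \<le> x $ i \<and> x $ i \<le> u"
proof -
  have "convex {x::plane. inner (axis i 1) x \<ge> l} \<and> convex {x::plane. inner (axis i 1) x \<le> u}"
    by (simp add: convex_halfspace_ge convex_halfspace_le)
  then have "convex {x::plane. l \<le> x $ i \<and> x $ i \<le> u}"
    by (auto simp: inner_axis' Collect_conj_eq intro!: convex_Int)
  then have "convex hull S \<subseteq> {x. l \<le> x $ i \<and> x $ i \<le> u}"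
    using assms(2) by (intro hull_minimal) auto
  then show ?thesis using assms(1) by blast
qed

section \<open>The point group of the tessellation\<close>

text \<open>The union of all squares, a family of parallel horizontal strips separated by the strips of
  triangles. It is what makes the horizontal direction intrinsic to the tessellation.\<close>

definition strips :: "plane set" where
  "strips = (\<Union>p\<in>periods. square_at p)"

lemma strips_height:
  assumes "x \<in> strips"
  obtains n :: int where "n * (1 + sqrt 3 / 2) \<le> x $ 2" "x $ 2 \<le> n * (1 + sqrt 3 / 2) + 1"
proof -
  from assms obtain p where p: "p \<in> periods" "x \<in> square_at p" by (auto simp: strips_def)
  then obtain m n :: int where pe: "p = tvec m n" by (auto simp: periods_def)
  from p(2) have "p $ 2 \<le> x $ 2 \<and> x $ 2 \<le> p $ 2 + 1"
    unfolding square_at_def by (rule convex_hull_nth_bounds) auto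
  with that[of n] show ?thesis by (simp add: pe tvec_nth)
qed

lemma horizontal_axis_strips: "x *\<^sub>R e1 \<in> strips"
proof -
  define p where "p = tvec (of_int \<lfloor>x\<rfloor>) (of_int 0)"
  have "p \<in> periods" unfolding periods_def p_def by blast
  moreover have "x *\<^sub>R e1 \<in> square_at p"
  proof -
    have "x *\<^sub>R e1 = (1 - frac x) *\<^sub>R p + frac x *\<^sub>R (p + e1)"
      by (simp add: p_def tvec_def frac_def algebra_simps)
    moreover have "p \<in> square_at p" "p + e1 \<in> square_at p"
      by (simp_all add: square_at_def hull_inc)
    moreover have "convex (square_at p)" by (simp add: square_at_def)
    ultimately show ?thesis
      using frac_ge_0[of x] frac_lt_1[of x] by (simp add: convexD)
  qed
  ultimately show ?thesis by (auto simp: strips_def)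
qed

text \<open>The diameter tells squares from triangles: it is \<open>sqrt 2\<close> for the former and 1 for the
  latter, because the diameter of a convex hull is attained at two of its vertices.\<close>

lemma faces_at_wide:
  assumes "f \<in> faces_at p" "x \<in> f" "y \<in> f" "norm (x - y) > 1"
  shows "f = square_at p"
proof (rule ccontr)
  assume "f \<noteq> square_at p"
  then consider "f = up_triangle_at p" | "f = down_triangle_at p"
    using assms(1) by (auto simp: faces_at_def)
  then have "\<exists>S. finite S \<and> f = convex hull S \<and> (\<forall>u\<in>S. \<forall>v\<in>S. norm (u - v) \<le> 1)"
  proof cases
    case 1
    then show ?thesis
      by (intro exI[of _ "{p + up, p + up + e1, p + e2}"])
        (simp add: up_triangle_at_def norm_plane power2_eq_square algebra_simps)
  next
    case 2
    then show ?thesis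
      by (intro exI[of _ "{p + up + e1, p + e2, p + e2 + e1}"])
        (simp add: down_triangle_at_def norm_plane power2_eq_square algebra_simps)
  qed
  then obtain S where "finite S" "f = convex hull S" "\<forall>u\<in>S. \<forall>v\<in>S. norm (u - v) \<le> 1" by blast
  then show False using simplex_extremal_le_exists[of S x y] assms(2-4) by fastforce
qed

text \<open>A symmetry preserves diameters, hence maps squares to squares.\<close>

lemma Aut_strips:
  assumes g: "g \<in> carrier Aut_tau" and x: "x \<in> strips"
  shows "g x \<in> strips"
proof -
  have d: "dist (g x) (g y) = dist x y" and t: "(\<lambda>f. g ` f) ` tau = tau" for x y
    using g by (auto simp: Aut_tau_def)
  from x obtain p where p: "p \<in> periods" "x \<in> square_at p" by (auto simp: strips_def)
  then have "square_at p \<in> tau" by (auto simp: tau_periods faces_at_def)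
  then have "g ` square_at p \<in> tau" using t by blast
  then obtain q where q: "q \<in> periods" "g ` square_at p \<in> faces_at q" by (auto simp: tau_periods)
  have "p \<in> square_at p" "p + e1 + up \<in> square_at p" by (simp_all add: square_at_def hull_inc)
  moreover have "norm (g p - g (p + e1 + up)) > 1"
    using d[of p "p + e1 + up"] by (simp add: dist_norm norm_plane)
  ultimately have "g ` square_at p = square_at q"
    by (intro faces_at_wide[OF q(2)]) auto
  then show ?thesis using p q(1) by (auto simp: strips_def)
qed

text \<open>The Klein four-group generated by the reflections in a vertical and in a horizontal line.\<close>

definition point_group :: "(plane \<Rightarrow> plane) set" where
  "point_group = {\<lambda>x. x, \<lambda>x. - x, flip, \<lambda>x. - flip x}"

text \<open>The image of the horizontal axis is a line inside the union of the square strips. As these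
  strips are separated by gaps, the line has to be horizontal again, so the linear part maps
  \<open>e1\<close> to \<open>e1\<close> or \<open>- e1\<close> and, being orthogonal, \<open>up\<close> to \<open>up\<close> or \<open>- up\<close>.\<close>

lemma Aut_linear_part:
  assumes g: "g \<in> carrier Aut_tau"
  obtains A where "A \<in> point_group" "g = (\<lambda>x. g 0 + A x)"
proof -
  define A where "A = (\<lambda>x. g x - g 0)"
  have gA: "g x = g 0 + A x" for x by (simp add: A_def)
  have "orthogonal_transformation A"
    using g by (simp add: orthogonal_transformation_isometry A_def Aut_tau_def dist_norm)
  then have A: "linear A" and ip: "inner (A x) (A y) = inner x y" for x y
    by (auto simp: orthogonal_transformation_def)
  have e1: "(A e1) $ 2 = 0"
  proof (rule ccontr)
    assume nz: "(A e1) $ 2 \<noteq> 0"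
    \<comment> \<open>A non-horizontal line has a point at half height of the strip of triangles with base at height 1.\<close>
    define x where "x = (1 + sqrt 3 / 4 - g 0 $ 2) / (A e1) $ 2"
    have "g (x *\<^sub>R e1) \<in> strips" using Aut_strips[OF g] horizontal_axis_strips by blast
    moreover have "g (x *\<^sub>R e1) $ 2 = 1 + sqrt 3 / 4"
    proof -
      have "g (x *\<^sub>R e1) $ 2 = g 0 $ 2 + x * (A e1) $ 2"
        by (subst gA) (simp add: linear_cmul[OF A])
      then show ?thesis using nz by (simp add: x_def)
    qed
    ultimately obtain n :: int where n: "n * (1 + sqrt 3 / 2) \<le> 1 + sqrt 3 / 4"
        "1 + sqrt 3 / 4 \<le> n * (1 + sqrt 3 / 2) + 1"
      by (metis strips_height)
    have s: "sqrt 3 > (0::real)" by simp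
    consider "n \<le> 0" | "n \<ge> 1" by linarith
    then show False
    proof cases
      case 1
      then have "n * (1 + sqrt 3 / 2) \<le> 0" by (simp add: mult_nonpos_nonneg)
      with n s show False by linarith
    next
      case 2
      then have "1 * (1 + sqrt 3 / 2) \<le> n * (1 + sqrt 3 / 2)" by (intro mult_right_mono) auto
      from order_trans[OF this n(1)] show False by simp
    qed
  qed
  have i: "inner x y = x $ 1 * y $ 1 + x $ 2 * y $ 2" for x y :: plane
    by (simp add: inner_vec_def sum_2)
  have e1': "(A e1) $ 1 = 1 \<or> (A e1) $ 1 = - 1"
    using ip[of e1 e1] e1 by (simp add: i power2_eq_1_iff flip: power2_eq_square)
  have up: "(A up) $ 1 = 0" using ip[of e1 up] e1 e1' by (auto simp: i)
  have up': "(A up) $ 2 = 1 \<or> (A up) $ 2 = - 1"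
    using ip[of up up] up by (simp add: i power2_eq_1_iff flip: power2_eq_square)
  have Ax: "A x = x $ 1 *\<^sub>R A e1 + x $ 2 *\<^sub>R A up" for x
  proof -
    have "x = x $ 1 *\<^sub>R e1 + x $ 2 *\<^sub>R up" by (simp add: plane_eq_iff)
    then show ?thesis by (metis linear_add[OF A] linear_cmul[OF A])
  qed
  define a d where "a = (A e1) $ 1" and "d = (A up) $ 2"
  have "(A x) $ 1 = x $ 1 * a" "(A x) $ 2 = x $ 2 * d" for x
    using arg_cong[OF Ax[of x], of "\<lambda>v. v $ 1"] arg_cong[OF Ax[of x], of "\<lambda>v. v $ 2"]
    by (simp_all add: a_def d_def e1 up)
  then have "A = (\<lambda>x. vector [x $ 1 * a, x $ 2 * d])"
    by (simp add: fun_eq_iff plane_eq_iff)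
  moreover have "a = 1 \<or> a = - 1" "d = 1 \<or> d = - 1" using e1' up' by (simp_all add: a_def d_def)
  ultimately have "A \<in> point_group"
    by (auto simp: point_group_def fun_eq_iff plane_eq_iff)
  then show thesis using that gA by blast
qed

section \<open>Orbits on flags and the normalizer\<close>

interpretation Aut: group Aut_tau
  by (rule group_Aut_tau)

lemma Aut_simps [simp]: "mult Aut_tau = (\<circ>)" "one Aut_tau = id"
  by (simp_all add: Aut_tau_def)

lemma point_group_linear:
  assumes "A \<in> point_group" shows "linear A" "inj A"
proof -
  have "A (A x) = x" for x
    using assms linear_neg[OF linear_flip] by (auto simp: point_group_def)
  then show "inj A" by (metis injI)
  show "linear A"
    using assms linear_flip linear_compose_neg[OF linear_flip] linear_id linear_compose_neg[OF linear_id]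
    by (auto simp: point_group_def id_def)
qed

definition move_flag :: "(plane \<Rightarrow> plane) \<Rightarrow> plane \<times> plane set \<times> plane set \<Rightarrow> plane \<times> plane set \<times> plane set" where
  "move_flag g = (\<lambda>(v, e, f). (g v, g ` e, g ` f))"

lemma move_flag_comp: "move_flag (g \<circ> h) x = move_flag g (move_flag h x)"
  by (cases x) (simp add: move_flag_def image_comp)

lemma move_flag_id [simp]: "move_flag id x = x"
  by (cases x) (simp add: move_flag_def)

lemma move_flag_flags:
  assumes g: "g \<in> carrier Aut_tau" and x: "x \<in> flags"
  shows "move_flag g x \<in> flags"
proof -
  obtain v e f where xe: "x = (v, e, f)" by (cases x)
  with x have f: "f \<in> tau" "e edge_of f" "v extreme_point_of e" by (auto simp: flags_def)
  from Aut_linear_part[OF g] obtain A where A: "A \<in> point_group" "g = (\<lambda>x. g 0 + A x)" .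
  note lin = point_group_linear[OF A(1)]
  have im: "g ` S = (+) (g 0) ` (A ` S)" for S
    by (subst A(2)) (simp add: image_image)
  have face: "g ` c face_of g ` S \<longleftrightarrow> c face_of S" for c S
    by (simp add: im face_of_linear_image[OF lin])
  have "g ` f \<in> tau" using g f(1) by (auto simp: Aut_tau_def)
  moreover have "g ` e edge_of g ` f"
  proof -
    have "aff_dim (g ` e) = aff_dim e"
      by (simp add: im aff_dim_translation_eq lin)
    then show ?thesis using f(2) face by (simp add: edge_of_def)
  qed
  moreover have "g v extreme_point_of g ` e"
    using f(3) face[of "{v}" e] by (simp add: face_of_singleton)
  ultimately show ?thesis by (simp add: flags_def move_flag_def xe)
qed

definition flag_orbit :: "(plane \<Rightarrow> plane) set \<Rightarrow> plane \<times> plane set \<times> plane set \<Rightarrow> (plane \<times> plane set \<times> plane set) set" where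
  "flag_orbit N x = (\<lambda>g. move_flag g x) ` N"

lemma flag_act_eq_move_flag: "x \<in> flags \<Longrightarrow> flag_act g x = move_flag g x"
  by (simp add: flag_act_def move_flag_def)

lemma orbit_flag_act:
  "x \<in> flags \<Longrightarrow> orbit (Aut_tau\<lparr>carrier := N\<rparr>) flag_act x = flag_orbit N x"
  by (auto simp: orbit_def flag_orbit_def flag_act_eq_move_flag)

lemma orbits_eq_image: "orbits G E \<phi> = orbit G \<phi> ` E"
  by (simp only: orbits_def Setcompr_eq_image Collect_mem_eq)

lemma orbits_flag_act: "orbits (Aut_tau\<lparr>carrier := N\<rparr>) flags flag_act = flag_orbit N ` flags"
  unfolding orbits_eq_image by (intro image_cong refl orbit_flag_act)

lemma flag_orbit_refl: "subgroup N Aut_tau \<Longrightarrow> x \<in> flag_orbit N x"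
  unfolding flag_orbit_def using subgroup.one_closed[of N Aut_tau] by (intro image_eqI[of _ _ id]) simp_all

lemma flag_orbit_eq:
  assumes N: "subgroup N Aut_tau" and y: "y \<in> flag_orbit N x"
  shows "flag_orbit N y = flag_orbit N x"
proof -
  from y obtain g where g: "g \<in> N" "y = move_flag g x" by (auto simp: flag_orbit_def)
  have gc: "g \<in> carrier Aut_tau" by (rule subgroup.mem_carrier[OF N g(1)])
  have i: "inv\<^bsub>Aut_tau\<^esub> g \<in> N" by (rule subgroup.m_inv_closed[OF N g(1)])
  have c: "h \<circ> k \<in> N" if "h \<in> N" "k \<in> N" for h k
    using subgroup.m_closed[OF N that] by simp
  have gi: "inv\<^bsub>Aut_tau\<^esub> g \<circ> g = id" using Aut.l_inv[OF gc] by simp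
  have 1: "move_flag h y = move_flag (h \<circ> g) x" for h by (simp add: move_flag_comp g(2))
  have 2: "move_flag h x = move_flag (h \<circ> inv\<^bsub>Aut_tau\<^esub> g) y" for h
    by (simp only: 1 comp_assoc gi comp_id)
  show ?thesis
  proof (intro equalityI subsetI)
    fix z assume "z \<in> flag_orbit N y"
    then obtain h where "h \<in> N" "z = move_flag h y" by (auto simp: flag_orbit_def)
    then show "z \<in> flag_orbit N x" using 1[of h] c[OF _ g(1), of h] unfolding flag_orbit_def by blast
  next
    fix z assume "z \<in> flag_orbit N x"
    then obtain h where "h \<in> N" "z = move_flag h x" by (auto simp: flag_orbit_def)
    then show "z \<in> flag_orbit N y" using 2[of h] c[OF _ i, of h] unfolding flag_orbit_def by blast
  qed
qed

lemma flag_orbit_flags: "subgroup N Aut_tau \<Longrightarrow> x \<in> flags \<Longrightarrow> flag_orbit N x \<subseteq> flags"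
  using move_flag_flags[of _ x] subgroup.subset[of N Aut_tau] by (auto simp: flag_orbit_def simp del: split_paired_All)

lemma subgroup_normalizer: "subgroup G Aut_tau \<Longrightarrow> subgroup (normalizer Aut_tau G) Aut_tau"
  by (simp add: Aut.normalizer_imp_subgroup subgroup.subset)

text \<open>The action of the cosets of \<open>G\<close> on the \<open>G\<close>-orbits is given by representatives because \<open>G\<close> is
  normal in its normalizer.\<close>

lemma map_act_coset:
  assumes G: "subgroup G Aut_tau" and n: "n \<in> normalizer Aut_tau G" and x: "x \<in> flags"
  shows "map_act G (G #>\<^bsub>Aut_tau\<^esub> n) (flag_orbit G x) = flag_orbit G (move_flag n x)"
proof -
  define N where "N = normalizer Aut_tau G"
  interpret norm: normal G "Aut_tau\<lparr>carrier := N\<rparr>"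
    unfolding N_def by (rule Aut.subgroup_in_normalizer[OF G])
  have coset: "G #>\<^bsub>Aut_tau\<^esub> n = n <#\<^bsub>Aut_tau\<^esub> G"
    using norm.coset_eq n by (simp add: N_def r_coset_def l_coset_def)
  have one: "id \<in> G" using subgroup.one_closed[OF G] by simp
  have mult: "g \<circ> h \<in> G" if "g \<in> G" "h \<in> G" for g h
    using subgroup.m_closed[OF G that] by simp
  have "map_act G (G #>\<^bsub>Aut_tau\<^esub> n) (flag_orbit G x) = (\<Union>g\<in>G. flag_act (g \<circ> n) ` flag_orbit G x)"
    using x by (auto simp: map_act_def map_flags_def orbits_flag_act r_coset_def)
  also have "\<dots> = (\<Union>g\<in>G. move_flag (g \<circ> n) ` flag_orbit G x)"
    using flag_orbit_flags[OF G x] by (intro SUP_cong image_cong refl flag_act_eq_move_flag) auto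
  also have "\<dots> = flag_orbit G (move_flag n x)"
  proof (intro equalityI subsetI)
    fix z assume "z \<in> (\<Union>g\<in>G. move_flag (g \<circ> n) ` flag_orbit G x)"
    then obtain g h where gh: "g \<in> G" "h \<in> G" "z = move_flag g (move_flag (n \<circ> h) x)"
      by (auto simp: flag_orbit_def move_flag_comp)
    have "n \<circ> h \<in> G #>\<^bsub>Aut_tau\<^esub> n" using gh(2) by (auto simp: coset l_coset_def)
    then obtain k where "k \<in> G" "n \<circ> h = k \<circ> n" by (auto simp: r_coset_def)
    then have "z = move_flag (g \<circ> k) (move_flag n x)" "g \<circ> k \<in> G"
      using gh mult by (simp_all add: move_flag_comp)
    then show "z \<in> flag_orbit G (move_flag n x)" by (auto simp: flag_orbit_def)
  next
    fix z assume "z \<in> flag_orbit G (move_flag n x)"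
    then obtain g where "g \<in> G" "z = move_flag (g \<circ> n) x" by (auto simp: flag_orbit_def move_flag_comp)
    moreover have "x \<in> flag_orbit G x" using flag_orbit_refl[OF G] .
    ultimately show "z \<in> (\<Union>g\<in>G. move_flag (g \<circ> n) ` flag_orbit G x)" by blast
  qed
  finally show ?thesis .
qed

text \<open>An orbit of the automorphism group of the map consists of the \<open>G\<close>-orbits contained in one
  orbit of the normalizer, and taking unions recovers the latter. The number of flag orbits
  of the map is therefore a number of orbits on the flags of the tessellation itself.\<close>

lemma card_orbits_map:
  assumes G: "subgroup G Aut_tau"
  shows "card (orbits (Aut_map G) (map_flags G) (map_act G)) = card (flag_orbit (normalizer Aut_tau G) ` flags)"
proof -
  define N where "N = normalizer Aut_tau G"
  have N: "subgroup N Aut_tau" unfolding N_def by (rule subgroup_normalizer[OF G])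
  interpret norm: normal G "Aut_tau\<lparr>carrier := N\<rparr>"
    unfolding N_def by (rule Aut.subgroup_in_normalizer[OF G])
  have GN: "G \<subseteq> N" using norm.subset by simp
  have "orbit (Aut_map G) (map_act G) (flag_orbit G x) = flag_orbit G ` flag_orbit N x" if x: "x \<in> flags" for x
  proof -
    have "orbit (Aut_map G) (map_act G) (flag_orbit G x) = (\<lambda>n. map_act G (G #>\<^bsub>Aut_tau\<^esub> n) (flag_orbit G x)) ` N"
      by (auto simp: orbit_def Aut_map_def FactGroup_def RCOSETS_def r_coset_def N_def)
    also have "\<dots> = (\<lambda>n. flag_orbit G (move_flag n x)) ` N"
      using map_act_coset[OF G _ x] by (intro image_cong) (auto simp: N_def)
    finally show ?thesis by (simp add: flag_orbit_def image_image)
  qed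
  then have "orbits (Aut_map G) (map_flags G) (map_act G) = (\<lambda>Z. flag_orbit G ` Z) ` flag_orbit N ` flags"
    unfolding map_flags_def orbits_flag_act by (simp add: orbits_eq_image image_image)
  moreover have "inj_on (\<lambda>Z. flag_orbit G ` Z) (flag_orbit N ` flags)"
  proof (rule inj_on_inverseI[where g = Union])
    fix Z assume "Z \<in> flag_orbit N ` flags"
    then obtain x where Z: "Z = flag_orbit N x" by blast
    have "flag_orbit G z \<subseteq> Z" if "z \<in> Z" for z
    proof -
      have "flag_orbit G z \<subseteq> flag_orbit N z" using GN by (auto simp: flag_orbit_def)
      also have "\<dots> = Z" using flag_orbit_eq[OF N] that unfolding Z by blast
      finally show ?thesis .
    qed
    moreover have "z \<in> flag_orbit G z" for z by (rule flag_orbit_refl[OF G])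
    ultimately show "\<Union> (flag_orbit G ` Z) = Z" by blast
  qed
  ultimately show ?thesis by (simp add: card_image N_def)
qed

section \<open>Almost regular maps and reflection-invariant lattices\<close>

lemma finite_flags_of_polytope:
  assumes "polytope f" shows "finite {(v, e). e edge_of f \<and> v extreme_point_of e}"
proof -
  have "finite {v. v extreme_point_of e}" if "e edge_of f" for e
  proof -
    have "polytope e" using assms that face_of_polytope_polytope by (auto simp: edge_of_def)
    then have "finite {F. F face_of e}" by (rule finite_polytope_faces)
    then have "finite ((\<lambda>v. {v}) -` {F. F face_of e})" by (rule finite_vimageI) (auto intro: injI)
    then show ?thesis by (simp add: vimage_def face_of_singleton)
  qed
  moreover have "finite {e. e edge_of f}"
    using finite_polytope_faces[OF assms] by (rule rev_finite_subset) (auto simp: edge_of_def)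
  ultimately have "finite (SIGMA e:{e. e edge_of f}. {v. v extreme_point_of e})" by auto
  then have "finite ((\<lambda>(e, v). (v, e)) ` (SIGMA e:{e. e edge_of f}. {v. v extreme_point_of e}))"
    by (rule finite_imageI)
  then show ?thesis by (rule rev_finite_subset) force
qed

text \<open>Every flag can be translated into the cell at the origin, which has only finitely many
  flags. Finiteness matters since equality of cardinalities carries no information about
  infinite sets.\<close>

lemma finite_orbits:
  assumes N: "subgroup N Aut_tau" and per: "(+) ` periods \<subseteq> N"
  shows "finite (flag_orbit N ` flags)"
proof -
  define F where "F = (\<Union>f\<in>faces_at 0. (\<lambda>(v, e). (v, e, f)) ` {(v, e). e edge_of f \<and> v extreme_point_of e})"
  have "polytope f" if "f \<in> faces_at 0" for f
    using that by (auto simp: faces_at_def square_at_def up_triangle_at_def down_triangle_at_def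
        intro: polytope_convex_hull)
  then have "finite F"
    unfolding F_def by (intro finite_UN_I finite_imageI finite_flags_of_polytope)
      (auto simp: faces_at_def)
  moreover have "flag_orbit N ` flags \<subseteq> flag_orbit N ` F"
  proof
    fix Z assume "Z \<in> flag_orbit N ` flags"
    then obtain x where x: "x \<in> flags" "Z = flag_orbit N x" by blast
    obtain v e f where xe: "x = (v, e, f)" by (cases x)
    with x obtain p where p: "p \<in> periods" "f \<in> faces_at p" by (auto simp: flags_def tau_periods)
    have np: "(+) (- p) \<in> N" using per periods_uminus[OF p(1)] by blast
    then have "move_flag ((+) (- p)) x \<in> flags" by (rule move_flag_flags[OF subgroup.mem_carrier[OF N] x(1)])
    moreover have "(+) (- p) ` f \<in> faces_at 0"
      using p(2) faces_at_translation[of "- p" p] by force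
    ultimately have "move_flag ((+) (- p)) x \<in> F"
      by (auto simp: F_def flags_def move_flag_def xe)
    moreover have "flag_orbit N (move_flag ((+) (- p)) x) = Z"
      unfolding x(2) by (rule flag_orbit_eq[OF N]) (use np in \<open>auto simp: flag_orbit_def\<close>)
    ultimately show "Z \<in> flag_orbit N ` F" by blast
  qed
  ultimately show ?thesis by (metis finite_imageI finite_subset)
qed

text \<open>The action is free on all flags, but one flag with trivial stabilizer is enough to separate
  the elements of the group. This flag sits in the left corner of its triangle, so that each
  of the three nontrivial linear parts visibly moves it.\<close>

definition base_flag :: "plane \<times> plane set \<times> plane set" where
  "base_flag = (up, convex hull {up, up + e1}, up_triangle_at 0)"

lemma base_flag: "base_flag \<in> flags"
proof -
  have ne: "up \<noteq> up + e1" "up \<noteq> e2" "up + e1 \<noteq> e2" by (simp_all add: plane_eq_iff)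
  have "\<not> collinear {up, up + e1, e2}"
  proof
    assume "collinear {up, up + e1, e2}"
    then obtain u where u: "\<And>x y. x \<in> {up, up + e1, e2} \<Longrightarrow> y \<in> {up, up + e1, e2} \<Longrightarrow> \<exists>c. x - y = c *\<^sub>R u"
      unfolding collinear_def by metis
    obtain c d where "up + e1 - up = c *\<^sub>R u" "e2 - up = d *\<^sub>R u"
      using u[of "up + e1" up] u[of e2 up] by auto
    then show False by (auto simp: plane_eq_iff)
  qed
  then have ind: "\<not> affine_dependent {up, up + e1, e2}"
    by (simp add: collinear_3_eq_affine_dependent)
  have "convex hull {up, up + e1} face_of up_triangle_at 0"
    unfolding up_triangle_at_def 
    using face_of_convex_hull_affine_independent[OF ind, of "convex hull {up, up + e1}"]
    by (auto intro!: exI[of _ "{up, up + e1}"])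
  moreover have "aff_dim (convex hull {up, up + e1}) = 1"
    using ne by (simp add: aff_dim_convex_hull)
  moreover have "up extreme_point_of (convex hull {up, up + e1})"
    by (simp add: extreme_point_of_convex_hull_2)
  moreover have "up_triangle_at 0 \<in> tau"
  proof -
    have "0 = tvec (of_int 0) (of_int 0)" by (simp add: tvec_def)
    then have "0 \<in> periods" unfolding periods_def by blast
    then show ?thesis by (auto simp: tau_periods faces_at_def)
  qed
  ultimately show ?thesis by (simp add: base_flag_def flags_def edge_of_def)
qed

lemma base_flag_stabilizer:
  assumes g: "g \<in> carrier Aut_tau" and fix_flag: "move_flag g base_flag = base_flag"
  shows "g = id"
proof -
  from Aut_linear_part[OF g] obtain A where A: "A \<in> point_group" "g = (\<lambda>x. g 0 + A x)" .
  have gup: "g up = up" and im: "g ` (convex hull {up, up + e1}) = convex hull {up, up + e1}"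
      "g ` up_triangle_at 0 = up_triangle_at 0"
    using fix_flag by (auto simp: move_flag_def base_flag_def)
  have gx: "g x = up - A up + A x" for x
    using gup A(2) by (metis add_diff_cancel)
  have "up + e1 \<in> convex hull {up, up + e1}" by (simp add: hull_inc)
  then have "g (up + e1) \<in> convex hull {up, up + e1}" using im(1) by blast
  then have 1: "0 \<le> g (up + e1) $ 1 \<and> g (up + e1) $ 1 \<le> 1"
    by (rule convex_hull_nth_bounds) auto
  have "e2 \<in> up_triangle_at 0" by (simp add: up_triangle_at_def hull_inc)
  then have "g e2 \<in> up_triangle_at 0" using im(2) by blast
  then have 2: "1 \<le> g e2 $ 2 \<and> g e2 $ 2 \<le> 1 + sqrt 3 / 2"
    unfolding up_triangle_at_def by (rule convex_hull_nth_bounds) auto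
  have "A = (\<lambda>x. x)"
    using A(1) 1 2 by (auto simp: point_group_def gx)
  then show ?thesis by (auto simp: gx)
qed

text \<open>Each orbit of the whole group is a union of orbits of the normalizer. If both kinds of
  orbits are equally many, finiteness forces them to coincide; then some element of the
  normalizer acts on the base flag as the reflection does, and the trivial stabilizer
  identifies the two.\<close>

lemma almost_regular_imp_flip_normalizes:
  assumes G: "subgroup G Aut_tau" and per: "(+) ` periods \<subseteq> normalizer Aut_tau G"
    and reg: "almost_regular G"
  shows "flip \<in> normalizer Aut_tau G"
proof -
  define N where "N = normalizer Aut_tau G"
  define C where "C = carrier Aut_tau"
  have N: "subgroup N Aut_tau" unfolding N_def by (rule subgroup_normalizer[OF G])
  have C: "subgroup C Aut_tau" unfolding C_def by (rule Aut.subgroup_self)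
  have NC: "N \<subseteq> C" using N subgroup.subset by (auto simp: C_def)
  define J where "J = (\<lambda>Z. \<Union>z\<in>Z. flag_orbit C z)"
  have J: "J (flag_orbit N x) = flag_orbit C x" for x
  proof -
    have "flag_orbit C z = flag_orbit C x" if "z \<in> flag_orbit N x" for z
      using that NC by (intro flag_orbit_eq[OF C]) (auto simp: flag_orbit_def)
    then have "J (flag_orbit N x) = (\<Union>z\<in>flag_orbit N x. flag_orbit C x)" unfolding J_def by (intro SUP_cong refl)
    also have "\<dots> = flag_orbit C x" using flag_orbit_refl[OF N, of x] by (metis UN_constant empty_iff)
    finally show ?thesis .
  qed
  then have "J ` flag_orbit N ` flags = flag_orbit C ` flags" by (simp add: image_image)
  moreover have "orbits Aut_tau flags flag_act = flag_orbit C ` flags"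
    using orbits_flag_act[of C] by (simp add: C_def)
  ultimately have "card (J ` flag_orbit N ` flags) = card (flag_orbit N ` flags)"
    using reg card_orbits_map[OF G] by (simp add: almost_regular_def N_def)
  then have inj: "inj_on J (flag_orbit N ` flags)"
    using finite_orbits[OF N] per by (intro eq_card_imp_inj_on) (simp_all add: N_def)
  have flip: "flip \<in> C" using flip_Aut by (simp add: C_def)
  then have "J (flag_orbit N (move_flag flip base_flag)) = J (flag_orbit N base_flag)"
    unfolding J by (intro flag_orbit_eq[OF C]) (auto simp: flag_orbit_def)
  then have "flag_orbit N (move_flag flip base_flag) = flag_orbit N base_flag"
    using inj_onD[OF inj] base_flag move_flag_flags[OF flip_Aut base_flag] by blast
  then have "move_flag flip base_flag \<in> flag_orbit N base_flag"
    using flag_orbit_refl[OF N] by metis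
  then obtain n where n: "n \<in> N" "move_flag flip base_flag = move_flag n base_flag" by (auto simp: flag_orbit_def)
  have "move_flag (flip \<circ> n) base_flag = move_flag (flip \<circ> flip) base_flag"
    by (simp only: move_flag_comp n(2))
  moreover have "flip \<circ> n \<in> carrier Aut_tau"
    using subgroup.m_closed[OF C flip, of n] n(1) NC by (auto simp: C_def)
  ultimately have "flip \<circ> n = id" using base_flag_stabilizer by simp
  then have "flip \<circ> (flip \<circ> n) = flip" by simp
  then have "n = flip" by (simp flip: comp_assoc)
  then show ?thesis using n(1) by (simp add: N_def)
qed

lemma inj_translation_map: "inj ((+) :: plane \<Rightarrow> plane \<Rightarrow> plane)"
  by (rule injI) (metis add_cancel_right_right)

text \<open>Conjugation of a translation by an isometry applies the linear part of the isometry to the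
  translation vector.\<close>

lemma normalizer_translations:
  assumes sub: "(+) ` \<Lambda> \<subseteq> carrier Aut_tau"
    and g: "g \<in> carrier Aut_tau" and A: "A \<in> point_group" "g = (\<lambda>x. s + A x)"
  shows "g \<in> normalizer Aut_tau ((+) ` \<Lambda>) \<longleftrightarrow> A ` \<Lambda> = \<Lambda>"
proof -
  have gi: "g \<circ> inv\<^bsub>Aut_tau\<^esub> g = id" using Aut.r_inv[OF g] by simp
  have "g \<circ> (+) t = (+) (A t) \<circ> g" for t
    using linear_add[OF point_group_linear(1)[OF A(1)]] by (simp add: A(2) fun_eq_iff)
  then have "g \<circ> (+) t \<circ> inv\<^bsub>Aut_tau\<^esub> g = (+) (A t)" for t
    by (metis comp_assoc comp_id gi)
  then have "g <#\<^bsub>Aut_tau\<^esub> ((+) ` \<Lambda>) #>\<^bsub>Aut_tau\<^esub> inv\<^bsub>Aut_tau\<^esub> g = (+) ` A ` \<Lambda>"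
    by (auto simp: l_coset_def r_coset_def image_iff)
  then show ?thesis
    using g sub by (simp add: normalizer_def stabilizer_def inj_image_eq_iff[OF inj_translation_map])
qed

text \<open>Translations and point reflections normalize every group of translations. Only one further
  condition remains: modulo them, the symmetry group is generated by the reflection.\<close>

theorem almost_regular_iff_flip_invariant:
  assumes G: "subgroup ((+) ` \<Lambda>) Aut_tau" and neg: "\<And>t. t \<in> \<Lambda> \<Longrightarrow> - t \<in> \<Lambda>"
  shows "almost_regular ((+) ` \<Lambda>) \<longleftrightarrow> flip ` \<Lambda> = \<Lambda>"
proof
  have sub: "(+) ` \<Lambda> \<subseteq> carrier Aut_tau" using G by (rule subgroup.subset)
  note norm = normalizer_translations[OF sub]
  have flip: "flip \<in> normalizer Aut_tau ((+) ` \<Lambda>) \<longleftrightarrow> flip ` \<Lambda> = \<Lambda>"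
    by (rule norm[where s = 0]) (simp_all add: flip_Aut point_group_def)
  show "flip ` \<Lambda> = \<Lambda>" if reg: "almost_regular ((+) ` \<Lambda>)"
  proof -
    have "(+) t \<in> normalizer Aut_tau ((+) ` \<Lambda>)" if "t \<in> periods" for t
      using norm[OF translation_Aut[OF that], of "\<lambda>x. x" t] by (simp add: point_group_def)
    then show ?thesis
      using almost_regular_imp_flip_normalizes[OF G _ reg] flip by blast
  qed
  show "almost_regular ((+) ` \<Lambda>)" if inv: "flip ` \<Lambda> = \<Lambda>"
  proof -
    have uminus: "uminus ` \<Lambda> = \<Lambda>" using neg by (force simp: image_iff)
    have "g \<in> normalizer Aut_tau ((+) ` \<Lambda>)" if g: "g \<in> carrier Aut_tau" for g
    proof -
      from Aut_linear_part[OF g] obtain A where A: "A \<in> point_group" "g = (\<lambda>x. g 0 + A x)" .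
      have "(\<lambda>x. - flip x) ` \<Lambda> = uminus ` flip ` \<Lambda>" by (simp add: image_image)
      then have "A ` \<Lambda> = \<Lambda>" using A(1) inv uminus by (auto simp: point_group_def)
      then show ?thesis using norm[OF g A] by simp
    qed
    then have "normalizer Aut_tau ((+) ` \<Lambda>) = carrier Aut_tau"
      using subgroup.subset[OF subgroup_normalizer[OF G]] by blast
    then show ?thesis
      using card_orbits_map[OF G] orbits_flag_act[of "carrier Aut_tau"]
      by (simp add: almost_regular_def)
  qed
qed

section \<open>Lattices of translations and minimal covers\<close>

definition lat :: "plane \<Rightarrow> plane \<Rightarrow> plane set" where
  "lat s t = {of_int m *\<^sub>R s + of_int n *\<^sub>R t | m n :: int. True}"

lemma latI: "of_int m *\<^sub>R s + of_int n *\<^sub>R t \<in> lat s t" for m n :: int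
  unfolding lat_def by blast

lemma latE:
  assumes "v \<in> lat s t"
  obtains m n :: int where "v = of_int m *\<^sub>R s + of_int n *\<^sub>R t"
  using assms unfolding lat_def by blast

lemma lat_diff: assumes "v \<in> lat s t" "w \<in> lat s t" shows "v - w \<in> lat s t"
proof -
  obtain m n where v: "v = of_int m *\<^sub>R s + of_int n *\<^sub>R t" using assms(1) by (rule latE)
  obtain m' n' where w: "w = of_int m' *\<^sub>R s + of_int n' *\<^sub>R t" using assms(2) by (rule latE)
  have "v - w = of_int (m - m') *\<^sub>R s + of_int (n - n') *\<^sub>R t"
    by (simp add: v w algebra_simps)
  then show ?thesis using latI by metis
qed

lemma lat_zero: "0 \<in> lat s t"
  using latI[of 0 s 0 t] by simp

lemma lat_uminus: "v \<in> lat s t \<Longrightarrow> - v \<in> lat s t"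
  using lat_diff[OF lat_zero] by force

lemma lat_add: "v \<in> lat s t \<Longrightarrow> w \<in> lat s t \<Longrightarrow> v + w \<in> lat s t"
  using lat_diff[of v s t "- w"] lat_uminus[of w s t] by simp

lemma inv_translation:
  assumes "(+) s \<in> carrier Aut_tau" shows "inv\<^bsub>Aut_tau\<^esub> ((+) s) = (+) (- s)"
proof
  fix x
  have "inv\<^bsub>Aut_tau\<^esub> ((+) s) \<circ> (+) s = id" using Aut.l_inv[OF assms] by simp
  from fun_cong[OF this, of "x - s"] show "(inv\<^bsub>Aut_tau\<^esub> ((+) s)) x = - s + x" by simp
qed

lemma comp_translation: "(+) s \<circ> (+) t = (+) (s + t)" for s t :: plane
  by (simp add: fun_eq_iff add.assoc)

lemma translation_multiple:
  assumes U: "subgroup U Aut_tau" and s: "(+) s \<in> U"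
  shows "(+) (of_int m *\<^sub>R s) \<in> U"
proof -
  have nat: "(+) (of_nat k *\<^sub>R s) \<in> U" for k
  proof (induction k)
    case 0
    then show ?case using subgroup.one_closed[OF U] by (simp add: id_def)
  next
    case (Suc k)
    have "(+) s \<circ> (+) (of_nat k *\<^sub>R s) = (+) (of_nat (Suc k) *\<^sub>R s)"
      by (simp add: comp_translation scaleR_add_left)
    then show ?case using subgroup.m_closed[OF U s Suc] by simp
  qed
  have neg: "(+) (- v) \<in> U" if "(+) v \<in> U" for v
    using subgroup.m_inv_closed[OF U that] inv_translation[OF subgroup.mem_carrier[OF U that]]
    by simp
  show ?thesis
  proof (cases "m \<ge> 0")
    case True
    then show ?thesis using nat[of "nat m"] by simp
  next
    case False
    then show ?thesis using neg[OF nat[of "nat (- m)"]] by simp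
  qed
qed

lemma trans_group_eq:
  assumes "(+) s \<in> carrier Aut_tau" "(+) t \<in> carrier Aut_tau"
  shows "trans_group s t = (+) ` lat s t" and "subgroup ((+) ` lat s t) Aut_tau"
proof -
  have inS: "(+) ` lat s t \<subseteq> U" if U: "subgroup U Aut_tau" "(+) s \<in> U" "(+) t \<in> U" for U
  proof
    fix g assume "g \<in> (+) ` lat s t"
    then obtain m n where g: "g = (+) (of_int m *\<^sub>R s + of_int n *\<^sub>R t)" by (auto elim!: latE)
    show "g \<in> U"
      using subgroup.m_closed[OF U(1) translation_multiple[OF U(1,2), of m]
          translation_multiple[OF U(1,3), of n]]
      by (simp add: g comp_translation)
  qed
  show sub: "subgroup ((+) ` lat s t) Aut_tau"
  proof (rule Aut.subgroupI)
    show car: "(+) ` lat s t \<subseteq> carrier Aut_tau" using inS[OF Aut.subgroup_self] assms by blast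
    show "(+) ` lat s t \<noteq> {}" using lat_zero by blast
    show "inv\<^bsub>Aut_tau\<^esub> g \<in> (+) ` lat s t" if "g \<in> (+) ` lat s t" for g
      using that car inv_translation lat_uminus by fastforce
    show "g \<otimes>\<^bsub>Aut_tau\<^esub> h \<in> (+) ` lat s t" if "g \<in> (+) ` lat s t" "h \<in> (+) ` lat s t" for g h
      using that by (auto simp: comp_translation lat_add)
  qed
  have "s \<in> lat s t" "t \<in> lat s t" using latI[of 1 s 0 t] latI[of 0 s 1 t] by simp_all
  then have "generate Aut_tau {(+) s, (+) t} \<subseteq> (+) ` lat s t"
    by (intro Aut.generate_subgroup_incl[OF _ sub]) auto
  moreover have "(+) ` lat s t \<subseteq> generate Aut_tau {(+) s, (+) t}"
    using assms by (intro inS Aut.generate_is_subgroup) (auto intro: generate.incl)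
  ultimately show "trans_group s t = (+) ` lat s t" unfolding trans_group_def by blast
qed

lemma toroidal_translations:
  assumes "toroidal H"
  obtains \<Lambda> where "H = (+) ` \<Lambda>" "subgroup ((+) ` \<Lambda>) Aut_tau" "\<forall>v\<in>\<Lambda>. - v \<in> \<Lambda>"
proof -
  from assms obtain s t where st: "(+) s \<in> carrier Aut_tau" "(+) t \<in> carrier Aut_tau" "H = trans_group s t"
    by (auto simp: toroidal_def T_tau_def)
  show thesis
    by (rule that[of "lat s t"]) (use trans_group_eq[OF st(1,2)] st(3) lat_uminus in auto)
qed

text \<open>Between groups of translations the covering relation is plain inclusion, so the order on
  maps can be handled as an order on sets of vectors.\<close>

lemma covers_iff: "covers H G \<longleftrightarrow> toroidal H \<and> toroidal G \<and> H \<subseteq> G"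
proof -
  have "subgroup H (Aut_tau\<lparr>carrier := G\<rparr>) \<longleftrightarrow> H \<subseteq> G" if "toroidal H" "toroidal G"
  proof -
    have sub: "subgroup K Aut_tau" if K: "toroidal K" for K
      by (rule toroidal_translations[OF K]) simp
    show ?thesis
    proof
      show "H \<subseteq> G" if "subgroup H (Aut_tau\<lparr>carrier := G\<rparr>)"
        using subgroup.subset[OF that] by simp
      show "subgroup H (Aut_tau\<lparr>carrier := G\<rparr>)" if "H \<subseteq> G"
        by (rule Aut.subgroup_incl[OF sub sub that]) fact+
    qed
  qed
  then show ?thesis by (auto simp: covers_def)
qed

text \<open>The vectors of \<open>\<Lambda>\<close> whose mirror image also belongs to \<open>\<Lambda>\<close> form the largest
  reflection-invariant subset of \<open>\<Lambda>\<close>. So among the almost regular covers there is a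
  least one, which is stronger than a unique minimal one.\<close>

lemma minimal_cover_unique:
  assumes G: "toroidal ((+) ` \<Lambda>)"
    and M: "toroidal ((+) ` {v \<in> \<Lambda>. flip v \<in> \<Lambda>})"
  shows "minimal_almost_regular_cover ((+) ` \<Lambda>) H \<longleftrightarrow> H = (+) ` {v \<in> \<Lambda>. flip v \<in> \<Lambda>}"
proof -
  define K where "K = {v \<in> \<Lambda>. flip v \<in> \<Lambda>}"
  note [simp] = inj_image_subset_iff[OF inj_translation_map] inj_image_eq_iff[OF inj_translation_map]
  have arK: "(+) ` K \<in> almost_regular_covers ((+) ` \<Lambda>)"
  proof -
    obtain \<Lambda>' where L: "(+) ` K = (+) ` \<Lambda>'" "subgroup ((+) ` \<Lambda>') Aut_tau" "\<forall>v\<in>\<Lambda>'. - v \<in> \<Lambda>'"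
      unfolding K_def by (rule toroidal_translations[OF M])
    then have "\<Lambda>' = K" by simp
    moreover have "flip ` K = K"
    proof (intro equalityI subsetI)
      fix v assume "v \<in> K"
      then have "flip v \<in> K" by (simp add: K_def)
      then show "v \<in> flip ` K" by (metis flip_flip(1) imageI)
    qed (auto simp: K_def)
    ultimately have "almost_regular ((+) ` K)"
      using almost_regular_iff_flip_invariant[OF L(2) bspec[OF L(3)]] by simp
    then show ?thesis using G M by (auto simp: almost_regular_covers_def covers_iff K_def)
  qed
  have le: "H \<subseteq> (+) ` K" if "H \<in> almost_regular_covers ((+) ` \<Lambda>)" for H
  proof -
    have H: "toroidal H" "H \<subseteq> (+) ` \<Lambda>" "almost_regular H"
      using that by (auto simp: almost_regular_covers_def covers_iff)
    obtain \<Lambda>' where L: "H = (+) ` \<Lambda>'" "subgroup ((+) ` \<Lambda>') Aut_tau" "\<forall>v\<in>\<Lambda>'. - v \<in> \<Lambda>'"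
      by (rule toroidal_translations[OF H(1)])
    have "flip ` \<Lambda>' = \<Lambda>'"
      using almost_regular_iff_flip_invariant[OF L(2) bspec[OF L(3)]] H(3) L(1) by simp
    moreover have "\<Lambda>' \<subseteq> \<Lambda>" using H(2) L(1) by simp
    ultimately have "\<Lambda>' \<subseteq> K" by (auto simp: K_def)
    then show ?thesis by (simp add: L(1))
  qed
  have tor: "toroidal H" if "H \<in> almost_regular_covers ((+) ` \<Lambda>)" for H
    using that by (auto simp: almost_regular_covers_def covers_iff)
  have "minimal_almost_regular_cover ((+) ` \<Lambda>) H \<longleftrightarrow> H = (+) ` K"
  proof
    assume "minimal_almost_regular_cover ((+) ` \<Lambda>) H"
    then have H: "H \<in> almost_regular_covers ((+) ` \<Lambda>)"
        "\<And>H'. H' \<in> almost_regular_covers ((+) ` \<Lambda>) \<Longrightarrow> covers H H' \<Longrightarrow> H' = H"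
      by (auto simp: minimal_almost_regular_cover_def)
    show "H = (+) ` K"
      using H(2)[OF arK] le[OF H(1)] tor[OF H(1)] tor[OF arK] by (simp add: covers_iff)
  next
    assume "H = (+) ` K"
    then show "minimal_almost_regular_cover ((+) ` \<Lambda>) H"
      using arK le by (auto simp: minimal_almost_regular_cover_def covers_iff)
  qed
  then show ?thesis by (simp add: K_def)
qed

text \<open>The functional identifies \<open>\<Lambda>\<close> modulo the sublattice with the integers modulo \<open>N\<close>;
  vectors on which it takes the values \<open>0, ..., N - 1\<close> represent the cosets.\<close>

lemma num_regions_functional:
  fixes \<phi> :: "plane \<Rightarrow> real" and N :: int
  assumes diff: "\<And>v w. v \<in> \<Lambda> \<Longrightarrow> w \<in> \<Lambda> \<Longrightarrow> v - w \<in> \<Lambda>"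
    and \<phi>: "linear \<phi>" "\<phi> ` \<Lambda> = range of_int" and N: "N > 0"
  shows "num_regions ((+) ` \<Lambda>) ((+) ` {v \<in> \<Lambda>. \<exists>k. \<phi> v = of_int (N * k)}) = nat N"
proof -
  define K where "K = {v \<in> \<Lambda>. \<exists>k. \<phi> v = of_int (N * k)}"
  define coset where "coset v = (+) ` (\<lambda>x. x + v) ` K" for v
  obtain u where u: "\<And>j. u j \<in> \<Lambda>" "\<And>j. \<phi> (u j) = of_int j"
  proof -
    have "\<forall>j. \<exists>v. v \<in> \<Lambda> \<and> \<phi> v = of_int j" using \<phi>(2) by (metis imageE rangeI)
    then show thesis using that by metis
  qed
  have \<phi>d: "\<phi> (v - w) = \<phi> v - \<phi> w" for v w by (rule linear_diff[OF \<phi>(1)])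
  have Kdiff: "v - w \<in> K" if "v \<in> K" "w \<in> K" for v w
  proof -
    from that obtain k l where "\<phi> v = of_int (N * k)" "\<phi> w = of_int (N * l)" by (auto simp: K_def)
    then have "\<phi> (v - w) = of_int (N * (k - l))" by (simp add: \<phi>d algebra_simps)
    moreover have "v - w \<in> \<Lambda>" using that diff by (simp add: K_def)
    ultimately show ?thesis unfolding K_def by blast
  qed
  have zero: "0 \<in> K"
    using diff[OF u(1) u(1), of 0 0] linear_0[OF \<phi>(1)] by (auto simp: K_def intro: exI[of _ 0])
  have coset_eq: "coset v = coset w \<longleftrightarrow> v - w \<in> K" for v w
  proof -
    have "(\<lambda>x. x + v) ` K = (\<lambda>x. x + w) ` K \<longleftrightarrow> v - w \<in> K"
    proof
      assume "(\<lambda>x. x + v) ` K = (\<lambda>x. x + w) ` K"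
      moreover have "v \<in> (\<lambda>x. x + v) ` K" using zero by force
      ultimately obtain x where "x \<in> K" "v = x + w" by blast
      then show "v - w \<in> K" by simp
    next
      assume vw: "v - w \<in> K"
      then have wv: "w - v \<in> K" using Kdiff[OF zero vw] by simp
      have "x + v \<in> (\<lambda>x. x + w) ` K" if "x \<in> K" for x
        using Kdiff[OF that wv] by (intro image_eqI[of _ _ "x - (w - v)"]) auto
      moreover have "x + w \<in> (\<lambda>x. x + v) ` K" if "x \<in> K" for x
        using Kdiff[OF that vw] by (intro image_eqI[of _ _ "x - (v - w)"]) auto
      ultimately show "(\<lambda>x. x + v) ` K = (\<lambda>x. x + w) ` K" by auto
    qed
    then show ?thesis by (simp add: coset_def inj_image_eq_iff[OF inj_translation_map])
  qed
  have "rcosets\<^bsub>Aut_tau\<lparr>carrier := (+) ` \<Lambda>\<rparr>\<^esub> ((+) ` K) = coset ` \<Lambda>"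
    by (auto simp: RCOSETS_def r_coset_def coset_def comp_translation image_iff)
  also have "\<dots> = (\<lambda>j. coset (u j)) ` {0..<N}"
  proof (intro equalityI subsetI)
    fix Z assume "Z \<in> coset ` \<Lambda>"
    then obtain v where v: "v \<in> \<Lambda>" "Z = coset v" by blast
    obtain i :: int where i: "\<phi> v = of_int i" using \<phi>(2) v(1) by blast
    have "\<phi> (v - u (i mod N)) = of_int (i - i mod N)" by (simp add: \<phi>d i u(2))
    also have "i - i mod N = N * (i div N)" by (simp add: minus_mod_eq_mult_div)
    finally have "v - u (i mod N) \<in> K" using diff[OF v(1) u(1)] by (auto simp: K_def)
    then have "Z = coset (u (i mod N))" by (simp add: v(2) coset_eq)
    then show "Z \<in> (\<lambda>j. coset (u j)) ` {0..<N}" using N by auto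
  qed (use u(1) in auto)
  finally have "rcosets\<^bsub>Aut_tau\<lparr>carrier := (+) ` \<Lambda>\<rparr>\<^esub> ((+) ` K) = (\<lambda>j. coset (u j)) ` {0..<N}" .
  moreover have "inj_on (\<lambda>j. coset (u j)) {0..<N}"
  proof (rule inj_onI)
    fix i j assume ij: "i \<in> {0..<N}" "j \<in> {0..<N}" "coset (u i) = coset (u j)"
    then obtain k where "\<phi> (u i - u j) = of_int (N * k)" by (auto simp: coset_eq K_def)
    then have "i - j = N * k" by (simp add: \<phi>d u(2)) (metis of_int_diff of_int_eq_iff of_int_mult)
    then have "N dvd i - j" by simp
    then have "i mod N = j mod N" by (simp add: mod_eq_dvd_iff)
    then show "i = j" using ij(1,2) by simp
  qed
  ultimately have "num_regions ((+) ` \<Lambda>) ((+) ` K) = nat N"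
    by (simp add: num_regions_def card_image)
  then show ?thesis unfolding K_def .
qed

section \<open>The reflection-invariant part of a lattice\<close>

lemma coprime_kernel:
  fixes p q m n :: int
  assumes "coprime p q" "m * q + n * p = 0"
  obtains k where "m = k * p" "n = - k * q"
proof (cases "p = 0")
  case True
  with assms have "q = 1 \<or> q = - 1" "m = 0" by auto
  with True show thesis by (intro that[of "- n * q"]) auto
next
  case False
  have "p dvd m * q" using assms(2) by (metis dvd_add_times_triv_right_iff dvd_0_right)
  then have "p dvd m" using assms(1) by (simp add: coprime_dvd_mult_left_iff)
  then obtain k where k: "m = k * p" by (metis dvdE mult.commute)
  with assms(2) have "p * (k * q + n) = 0" by (simp add: algebra_simps)
  with False have "n = - k * q" by simp
  with k show thesis by (rule that)
qed

text \<open>In coordinates with respect to a basis of the lattice, height and abscissa of \<open>(m, n)\<close> are,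
  up to constant factors, \<open>m * q + n * p\<close> and \<open>m * t + n * r\<close>; the left-hand side says that
  the mirror image of \<open>(m, n)\<close> is a lattice point \<open>(m', n')\<close>. The sum of a vector and its
  mirror image has abscissa 0, hence is a multiple of the primitive vector \<open>(r, - t)\<close>, whose
  height is \<open>- D\<close>. On the other hand its height is twice the height of \<open>(m, n)\<close>. Conversely,
  a suitable multiple of \<open>(r, - t)\<close> minus \<open>(m, n)\<close> is the mirror image.\<close>

lemma reflected_iff_dvd:
  fixes p q r t m n D :: int
  assumes cop: "coprime p q" "coprime r t" and D: "D = t * p - q * r" "D \<noteq> 0"
  shows "(\<exists>m' n'. m' * q + n' * p = m * q + n * p \<and> m' * t + n' * r = - (m * t + n * r))
    \<longleftrightarrow> D dvd 2 * (m * q + n * p)"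
proof
  assume "\<exists>m' n'. m' * q + n' * p = m * q + n * p \<and> m' * t + n' * r = - (m * t + n * r)"
  then obtain m' n' where mn: "m' * q + n' * p = m * q + n * p" "m' * t + n' * r = - (m * t + n * r)"
    by blast
  have "(m + m') * t + (n + n') * r = 0" using mn(2) by (simp add: algebra_simps)
  then obtain l where l: "m + m' = l * r" "n + n' = - l * t" by (rule coprime_kernel[OF cop(2)])
  have "2 * (m * q + n * p) = (m + m') * q + (n + n') * p" using mn(1) by (simp add: algebra_simps)
  also have "\<dots> = D * (- l)" by (simp only: l D(1)) (simp add: algebra_simps)
  finally show "D dvd 2 * (m * q + n * p)" by (rule dvdI)
next
  assume "D dvd 2 * (m * q + n * p)"
  then obtain j where j: "2 * (m * q + n * p) = D * j" by (rule dvdE)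
  have "(- m - j * r) * q + (- n + j * t) * p = D * j - (m * q + n * p)"
    by (simp add: D(1) algebra_simps)
  moreover have "(- m - j * r) * t + (- n + j * t) * r = - (m * t + n * r)"
    by (simp add: algebra_simps)
  ultimately show "\<exists>m' n'. m' * q + n' * p = m * q + n * p \<and> m' * t + n' * r = - (m * t + n * r)"
    using j by (intro exI[of _ "- m - j * r"] exI[of _ "- n + j * t"]) simp
qed

text \<open>Reading \<^term>\<open>flip\<close> in scaled coordinates turns the invariance of the lattice points into
  the preceding statement about integers.\<close>

lemma lat_reflection:
  fixes p q r t D :: int and \<gamma> \<delta> :: real
  assumes a: "a $ 1 = \<gamma> * of_int t" "a $ 2 = \<delta> * of_int q"
    and b: "b $ 1 = \<gamma> * of_int r" "b $ 2 = \<delta> * of_int p"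
    and nz: "\<gamma> \<noteq> 0" "\<delta> \<noteq> 0"
    and cop: "coprime p q" "coprime r t" and D: "D = t * p - q * r" "D \<noteq> 0"
  shows "{v \<in> lat a b. flip v \<in> lat a b}
    = {of_int m *\<^sub>R a + of_int n *\<^sub>R b | m n. D dvd 2 * (m * q + n * p)}"
proof -
  have nth: "(of_int m *\<^sub>R a + of_int n *\<^sub>R b) $ 1 = \<gamma> * of_int (m * t + n * r)"
      "(of_int m *\<^sub>R a + of_int n *\<^sub>R b) $ 2 = \<delta> * of_int (m * q + n * p)" for m n :: int
    by (simp_all add: a b algebra_simps)
  have eq: "flip (of_int m *\<^sub>R a + of_int n *\<^sub>R b) = of_int m' *\<^sub>R a + of_int n' *\<^sub>R b \<longleftrightarrow>
      m' * q + n' * p = m * q + n * p \<and> m' * t + n' * r = - (m * t + n * r)" for m n m' n'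
  proof -
    have "flip (of_int m *\<^sub>R a + of_int n *\<^sub>R b) = of_int m' *\<^sub>R a + of_int n' *\<^sub>R b \<longleftrightarrow>
        \<gamma> * of_int (- (m * t + n * r)) = \<gamma> * of_int (m' * t + n' * r) \<and>
        \<delta> * of_int (m * q + n * p) = \<delta> * of_int (m' * q + n' * p)"
      by (simp only: plane_eq_iff flip_nth nth of_int_minus mult_minus_right)
    also have "\<dots> \<longleftrightarrow> m' * q + n' * p = m * q + n * p \<and> m' * t + n' * r = - (m * t + n * r)"
      using nz by (simp only: mult_cancel_left of_int_eq_iff) auto
    finally show ?thesis .
  qed
  have flip_mem: "flip (of_int m *\<^sub>R a + of_int n *\<^sub>R b) \<in> lat a b \<longleftrightarrow> D dvd 2 * (m * q + n * p)" for m n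
  proof -
    have "flip (of_int m *\<^sub>R a + of_int n *\<^sub>R b) \<in> lat a b \<longleftrightarrow>
        (\<exists>m' n'. m' * q + n' * p = m * q + n * p \<and> m' * t + n' * r = - (m * t + n * r))"
      by (simp add: lat_def eq)
    also have "\<dots> \<longleftrightarrow> D dvd 2 * (m * q + n * p)"
      by (rule reflected_iff_dvd[OF cop D])
    finally show ?thesis .
  qed
  have "{v \<in> lat a b. flip v \<in> lat a b}
      = {of_int m *\<^sub>R a + of_int n *\<^sub>R b | m n. flip (of_int m *\<^sub>R a + of_int n *\<^sub>R b) \<in> lat a b}"
    by (subst (1) lat_def) blast
  then show ?thesis by (simp only: flip_mem)
qed

text \<open>The height, divided by its scale, is the functional that computes the index.\<close>

lemma num_regions_height:
  fixes p q N :: int and \<delta> :: real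
  assumes a: "a $ 2 = \<delta> * of_int q" and b: "b $ 2 = \<delta> * of_int p" and nz: "\<delta> \<noteq> 0"
    and cop: "coprime p q" and N: "N \<noteq> 0"
  shows "num_regions ((+) ` lat a b)
    ((+) ` {of_int m *\<^sub>R a + of_int n *\<^sub>R b | m n. N dvd m * q + n * p}) = nat \<bar>N\<bar>"
proof -
  define \<phi> where "\<phi> w = w $ 2 / \<delta>" for w :: plane
  have \<phi>: "\<phi> (of_int m *\<^sub>R a + of_int n *\<^sub>R b) = of_int (m * q + n * p)" for m n :: int
    using nz by (simp add: \<phi>_def a b field_simps)
  have "linear \<phi>" by (rule linearI) (simp_all add: \<phi>_def add_divide_distrib)
  moreover have "\<phi> ` lat a b = range of_int"
  proof (intro equalityI subsetI)
    fix z :: real assume "z \<in> \<phi> ` lat a b"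
    then obtain w where w: "w \<in> lat a b" "z = \<phi> w" by auto
    from w(1) obtain m n where "w = of_int m *\<^sub>R a + of_int n *\<^sub>R b" by (rule latE)
    then show "z \<in> range of_int" by (simp only: w(2) \<phi> rangeI)
  next
    fix z :: real assume "z \<in> range of_int"
    then obtain i :: int where i: "z = of_int i" by blast
    obtain m n where "m * q + n * p = 1"
      using bezout_int[of q p] cop by (metis coprime_commute coprime_imp_gcd_eq_1)
    then have "(i * m) * q + (i * n) * p = i" by (metis distrib_left mult.assoc mult.right_neutral)
    then have "z = \<phi> (of_int (i * m) *\<^sub>R a + of_int (i * n) *\<^sub>R b)" by (simp only: \<phi> i)
    then show "z \<in> \<phi> ` lat a b" using latI by blast
  qed
  moreover have "{of_int m *\<^sub>R a + of_int n *\<^sub>R b | m n. N dvd m * q + n * p}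
      = {w \<in> lat a b. \<exists>k. \<phi> w = of_int (\<bar>N\<bar> * k)}"
  proof -
    have "N dvd m * q + n * p \<longleftrightarrow> (\<exists>k. \<phi> (of_int m *\<^sub>R a + of_int n *\<^sub>R b) = of_int (\<bar>N\<bar> * k))" for m n
      by (simp only: \<phi> of_int_eq_iff) (metis abs_dvd_iff dvd_def)
    then show ?thesis unfolding lat_def by blast
  qed
  ultimately show ?thesis
    using num_regions_functional[of "lat a b" \<phi> "\<bar>N\<bar>"] N lat_diff by simp
qed

text \<open>Modulo 2 the pairs \<open>(p, q)\<close> and \<open>(r, t)\<close> are nonzero, and nonzero vectors over the field
  with two elements are parallel only if they are equal. This is where the case distinction
  of the main theorem comes from.\<close>

lemma even_det_iff:
  fixes p q r t :: int
  assumes "coprime p q" "coprime r t"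
  shows "even (t * p - q * r) \<longleftrightarrow> even (q - t) \<and> even (p - r)"
proof -
  have "\<not> (even p \<and> even q)" "\<not> (even r \<and> even t)"
    using assms by (metis coprime_common_divisor odd_one)+
  then show ?thesis by auto
qed

text \<open>The first generator spans the vectors of height 0 because \<open>(p, - q)\<close> is primitive; the
  second one has the smallest possible nonzero height, up to sign.\<close>

lemma sublattice_generators:
  fixes p q \<alpha> \<beta> N :: int
  assumes cop: "coprime p q" and N: "\<alpha> * q - \<beta> * p = - N"
  shows "{of_int m *\<^sub>R a + of_int n *\<^sub>R b | m n. N dvd m * q + n * p}
    = lat (of_int p *\<^sub>R a - of_int q *\<^sub>R b) (of_int \<alpha> *\<^sub>R a - of_int \<beta> *\<^sub>R b)" (is "?L = lat ?u ?v")
proof -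
  have comb: "of_int k *\<^sub>R ?u + of_int l *\<^sub>R ?v
      = of_int (k * p + l * \<alpha>) *\<^sub>R a + of_int (- k * q - l * \<beta>) *\<^sub>R b" for k l :: int
    by (simp add: algebra_simps)
  show ?thesis
  proof (intro equalityI subsetI)
    fix x assume "x \<in> ?L"
    then obtain m n where x: "x = of_int m *\<^sub>R a + of_int n *\<^sub>R b" and dvd: "N dvd m * q + n * p"
      by blast
    from dvd obtain j where j: "m * q + n * p = N * j" by (rule dvdE)
    have "(m + j * \<alpha>) * q + (n - j * \<beta>) * p = (m * q + n * p) + j * (\<alpha> * q - \<beta> * p)"
      by (simp add: algebra_simps)
    also have "\<dots> = 0" by (simp add: j N)
    finally obtain k where "m + j * \<alpha> = k * p" "n - j * \<beta> = - k * q"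
      by (rule coprime_kernel[OF cop])
    then have "m = k * p + (- j) * \<alpha>" "n = - k * q - (- j) * \<beta>" by linarith+
    then have "x = of_int k *\<^sub>R ?u + of_int (- j) *\<^sub>R ?v" by (simp only: comb x)
    then show "x \<in> lat ?u ?v" by (simp only: latI)
  next
    fix x assume "x \<in> lat ?u ?v"
    then obtain k l where x: "x = of_int k *\<^sub>R ?u + of_int l *\<^sub>R ?v" by (rule latE)
    have "(k * p + l * \<alpha>) * q + (- k * q - l * \<beta>) * p = l * (\<alpha> * q - \<beta> * p)"
      by (simp add: algebra_simps)
    then have "N dvd (k * p + l * \<alpha>) * q + (- k * q - l * \<beta>) * p" by (simp add: N)
    then show "x \<in> ?L" unfolding x comb by blast
  qed
qed

lemma toroidal_trans_group:
  assumes "(+) (tvec x y) \<in> carrier Aut_tau" "(+) (tvec x' y') \<in> carrier Aut_tau"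
    and det: "x * y' - y * x' \<noteq> 0"
  shows "toroidal (trans_group (tvec x y) (tvec x' y'))"
proof -
  have h: "1 + sqrt 3 / 2 \<noteq> (0::real)" by (smt (verit) real_sqrt_ge_zero divide_nonneg_nonneg)
  have sc: "tvec x y \<noteq> k *\<^sub>R tvec x' y'" for k
  proof
    assume "tvec x y = k *\<^sub>R tvec x' y'"
    then have eq: "x + y / 2 = k * (x' + y' / 2)"
        "y * (1 + sqrt 3 / 2) = (k * y') * (1 + sqrt 3 / 2)"
      by (simp_all add: plane_eq_iff tvec_nth)
    have "y = k * y'" using eq(2) h by (simp only: mult_cancel_right) simp
    moreover from this have "x = k * x'" using eq(1) by (simp add: algebra_simps)
    ultimately have "y = k * y'" "x = k * x'" by simp_all
    with det show False by simp
  qed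
  have ne: "tvec x' y' \<noteq> 0"
  proof
    assume "tvec x' y' = 0"
    then have "y' = 0" "x' = 0" using h by (auto simp: plane_eq_iff tvec_nth)
    with det show False by simp
  qed
  have "independent {tvec x y, tvec x' y'}"
    using sc ne by (auto simp: independent_insert span_singleton)
  moreover have "tvec x y \<noteq> tvec x' y'" using sc[of 1] by simp
  ultimately show ?thesis using assms(1,2) unfolding toroidal_def T_tau_def by blast
qed

section \<open>The minimal almost regular cover\<close>

theorem theorem4p4:
  fixes a1 a2 b1 b2 \<Delta> g1 g2 :: int
    and c d1 d2 :: real
    and both_even :: bool
    and G M :: "(plane \<Rightarrow> plane) set"
  assumes "\<Delta> = a1 * b2 - a2 * b1"
    and "\<Delta> \<noteq> 0"
    and "g1 = gcd a2 b2"
    and "g2 = gcd (2 * a1 + a2) (2 * b1 + b2)"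
    and "c = of_int \<Delta> / of_int g1"
    and "d1 = - (of_int \<Delta> / 2) * (1 / of_int g1 + 1 / of_int g2)"
    and "d2 = - (of_int \<Delta> / of_int g2)"
    and "both_even \<longleftrightarrow> even (a2 div g1 - (2 * a1 + a2) div g2) \<and> even (b2 div g1 - (2 * b1 + b2) div g2)"
    and "G = trans_group (tvec (of_int a1) (of_int a2)) (tvec (of_int b1) (of_int b2))"
    and "M = (if both_even then trans_group (tvec c 0) (tvec (- d1) (c + 2 * d1))
              else trans_group (tvec c 0) (tvec (- d2) (2 * d2)))"
  shows "(\<forall>H. minimal_almost_regular_cover G H \<longleftrightarrow> H = M) \<and>
         real (num_regions G M) =
           (if both_even then \<bar>of_int \<Delta> / of_int (g1 * g2)\<bar>
            else 2 * \<bar>of_int \<Delta> / of_int (g1 * g2)\<bar>)"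
proof -
  define h :: real where "h = 1 + sqrt 3 / 2"
  have h: "h > 0" unfolding h_def by (simp add: add_pos_nonneg)
  define a b where "a = tvec (of_int a1) (of_int a2)" and "b = tvec (of_int b1) (of_int b2)"
  have nz1: "b2 \<noteq> 0 \<or> a2 \<noteq> 0" using assms(1,2) by auto
  have nz2: "2 * b1 + b2 \<noteq> 0 \<or> 2 * a1 + a2 \<noteq> 0"
  proof (rule ccontr)
    assume "\<not> ?thesis"
    then have "b2 = - 2 * b1" "a2 = - 2 * a1" by auto
    then show False using assms(1,2) by simp
  qed
  have g: "g1 > 0" "g2 > 0" using nz1 nz2 by (auto simp: assms(3,4))
  define p q r t where "p = b2 div g1" and "q = a2 div g1"
    and "r = (2 * b1 + b2) div g2" and "t = (2 * a1 + a2) div g2"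
  have pq: "b2 = g1 * p" "a2 = g1 * q" by (simp_all add: p_def q_def assms(3))
  have rt: "2 * b1 + b2 = g2 * r" "2 * a1 + a2 = g2 * t" by (simp_all add: r_def t_def assms(4))
  have cop: "coprime p q" "coprime r t"
    using div_gcd_coprime[OF nz1] div_gcd_coprime[OF nz2]
    by (simp_all add: p_def q_def r_def t_def assms(3,4) gcd.commute)
  define D where "D = t * p - q * r"
  \<comment> \<open>Passing to the coordinates \<open>(2 x + y, y)\<close> doubles the determinant, and \<open>D\<close> is what remains after
      dividing them by \<open>g2\<close> and \<open>g1\<close>.\<close>
  have gD: "g1 * g2 * D = 2 * \<Delta>"
  proof -
    have "g1 * g2 * D = (g2 * t) * (g1 * p) - (g1 * q) * (g2 * r)"
      by (simp add: D_def algebra_simps)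
    also have "\<dots> = (2 * a1 + a2) * b2 - a2 * (2 * b1 + b2)" by (simp only: pq(1,2)[symmetric] rt[symmetric])
    also have "\<dots> = 2 * \<Delta>" by (simp add: assms(1) algebra_simps)
    finally show ?thesis .
  qed
  have D0: "D \<noteq> 0" using gD assms(2) by auto
  have even: "both_even \<longleftrightarrow> even D"
    unfolding D_def even_det_iff[OF cop] by (simp add: assms(8) p_def q_def r_def t_def)
  have parity: "both_even \<Longrightarrow> even (p + r) \<and> even (q + t)"
    using assms(8) by (auto simp: p_def q_def r_def t_def)
  define N where "N = (if both_even then D div 2 else D)"
  define \<alpha> where "\<alpha> = (if both_even then (p + r) div 2 else r)"
  define \<beta> where "\<beta> = (if both_even then (q + t) div 2 else t)"
  have N0: "N \<noteq> 0" using D0 even by (auto simp: N_def)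
  have \<alpha>2: "2 * \<alpha> = (if both_even then p + r else 2 * r)"
    using parity by (auto simp: \<alpha>_def)
  have \<beta>2: "2 * \<beta> = (if both_even then q + t else 2 * t)"
    using parity by (auto simp: \<beta>_def)
  have N2: "2 * N = (if both_even then D else 2 * D)"
    using even by (auto simp: N_def)
  \<comment> \<open>The pair \<open>(\<alpha>, - \<beta>)\<close> is the primitive vertical vector or, if both parities agree, half the sum of
      the primitive horizontal and the primitive vertical vector.\<close>
  have \<alpha>\<beta>: "\<alpha> * q - \<beta> * p = - N"
  proof -
    have "2 * (\<alpha> * q - \<beta> * p) = (2 * \<alpha>) * q - (2 * \<beta>) * p" by (simp add: algebra_simps)
    also have "\<dots> = - (2 * N)" by (simp only: \<alpha>2 \<beta>2 N2 D_def) (simp add: algebra_simps)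
    finally show ?thesis by simp
  qed
  have dvd: "D dvd 2 * y \<longleftrightarrow> N dvd y" for y
  proof (cases both_even)
    case True
    then have "D = 2 * N" using N2 by simp
    then show ?thesis by simp
  next
    case False
    then have "coprime D 2" using even by simp
    with False show ?thesis by (simp add: N_def coprime_dvd_mult_right_iff)
  qed
  define \<gamma> \<delta> where "\<gamma> = real_of_int g2 / 2" and "\<delta> = real_of_int g1 * h"
  have scale: "\<gamma> \<noteq> 0" "\<delta> \<noteq> 0" using g h by (simp_all add: \<gamma>_def \<delta>_def)
  have "2 * real_of_int a1 + real_of_int a2 = real_of_int g2 * real_of_int t"
      "2 * real_of_int b1 + real_of_int b2 = real_of_int g2 * real_of_int r"
    using arg_cong[OF rt(2), of real_of_int] arg_cong[OF rt(1), of real_of_int] by simp_all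
  then have a_nth: "a $ 1 = \<gamma> * of_int t" "a $ 2 = \<delta> * of_int q"
    and b_nth: "b $ 1 = \<gamma> * of_int r" "b $ 2 = \<delta> * of_int p"
    by (simp_all add: a_def b_def tvec_nth \<gamma>_def \<delta>_def pq h_def)
  define \<Lambda> where "\<Lambda> = lat a b"
  have per: "\<Lambda> \<subseteq> periods"
  proof
    fix v assume "v \<in> \<Lambda>"
    then obtain m n where "v = of_int m *\<^sub>R a + of_int n *\<^sub>R b" unfolding \<Lambda>_def by (rule latE)
    then have "v = tvec (of_int (m * a1 + n * b1)) (of_int (m * a2 + n * b2))"
      by (simp add: a_def b_def tvec_def algebra_simps)
    then show "v \<in> periods" unfolding periods_def by blast
  qed
  have car: "(+) v \<in> carrier Aut_tau" if "v \<in> \<Lambda>" for v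
    using that per translation_Aut by blast
  have ab: "a \<in> \<Lambda>" "b \<in> \<Lambda>" using latI[of 1 a 0 b] latI[of 0 a 1 b] by (simp_all add: \<Lambda>_def)
  have G: "G = (+) ` \<Lambda>"
    using trans_group_eq(1)[OF car[OF ab(1)] car[OF ab(2)]] by (simp add: assms(9) \<Lambda>_def a_def b_def)
  have torG: "toroidal G"
  proof -
    have "real_of_int a1 * real_of_int b2 - real_of_int a2 * real_of_int b1 \<noteq> 0"
      using assms(2) unfolding assms(1) by (simp flip: of_int_mult of_int_diff)
    then show ?thesis
      unfolding assms(9) by (intro toroidal_trans_group car[OF ab(1)[unfolded a_def]] car[OF ab(2)[unfolded b_def]])
  qed
  define K where "K = {v \<in> \<Lambda>. flip v \<in> \<Lambda>}"
  have K: "K = {of_int m *\<^sub>R a + of_int n *\<^sub>R b | m n. N dvd m * q + n * p}"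
    unfolding K_def \<Lambda>_def lat_reflection[OF a_nth b_nth scale cop D_def D0] by (simp only: dvd)
  define u where "u = of_int p *\<^sub>R a - of_int q *\<^sub>R b"
  define v where "v = of_int \<alpha> *\<^sub>R a - of_int \<beta> *\<^sub>R b"
  have Klat: "K = lat u v"
    unfolding K u_def v_def by (rule sublattice_generators[OF cop(1) \<alpha>\<beta>])
  define y where "y = (if both_even then c + 2 * d1 else 2 * d2)"
  define x where "x = (if both_even then - d1 else - d2)"
  have Mtv: "M = trans_group (tvec c 0) (tvec x y)"
    by (simp add: assms(10) x_def y_def)
  have \<Delta>g: "real_of_int \<Delta> = real_of_int g1 * c" "real_of_int \<Delta> = - real_of_int g2 * d2" "2 * d1 = d2 - c"
    using g by (simp_all add: assms(5-7) field_simps)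
  have u: "u = tvec c 0"
  proof -
    have "g1 * (p * a1 - q * b1) = \<Delta>"
      by (simp add: assms(1) pq algebra_simps)
    then have "real_of_int g1 * (real_of_int p * real_of_int a1 - real_of_int q * real_of_int b1) = real_of_int g1 * c"
      using \<Delta>g(1) by (metis of_int_diff of_int_mult)
    then have "real_of_int p * real_of_int a1 - real_of_int q * real_of_int b1 = c" using g by simp
    moreover have "real_of_int p * real_of_int a2 - real_of_int q * real_of_int b2 = 0" by (simp add: pq)
    moreover have "u = tvec (real_of_int p * real_of_int a1 - real_of_int q * real_of_int b1) (real_of_int p * real_of_int a2 - real_of_int q * real_of_int b2)"
      by (simp add: u_def a_def b_def tvec_def algebra_simps)
    ultimately show ?thesis by simp
  qed
  have w: "of_int r *\<^sub>R a - of_int t *\<^sub>R b = tvec (- d2) (2 * d2)"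
  proof -
    have "g2 * (r * a1 - t * b1) = (g2 * r) * a1 - (g2 * t) * b1" by (simp add: algebra_simps)
    also have "\<dots> = \<Delta>" by (simp only: rt[symmetric] assms(1)) (simp add: algebra_simps)
    finally have "real_of_int g2 * (real_of_int r * real_of_int a1 - real_of_int t * real_of_int b1) = real_of_int g2 * (- d2)"
      using \<Delta>g(2) by (metis minus_mult_commute of_int_diff of_int_mult)
    then have 1: "real_of_int r * real_of_int a1 - real_of_int t * real_of_int b1 = - d2"
      using g by (simp only: mult_cancel_left) simp
    have "g2 * (r * a2 - t * b2) = (g2 * r) * a2 - (g2 * t) * b2" by (simp add: algebra_simps)
    also have "\<dots> = - 2 * \<Delta>" by (simp only: rt[symmetric] assms(1)) (simp add: algebra_simps)
    finally have "real_of_int g2 * (real_of_int r * real_of_int a2 - real_of_int t * real_of_int b2) = - 2 * real_of_int \<Delta>"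
      by (metis of_int_diff of_int_minus of_int_mult of_int_numeral)
    also have "\<dots> = real_of_int g2 * (2 * d2)" by (simp add: \<Delta>g(2))
    finally have 2: "real_of_int r * real_of_int a2 - real_of_int t * real_of_int b2 = 2 * d2"
      using g by (simp only: mult_cancel_left) simp
    have "of_int r *\<^sub>R a - of_int t *\<^sub>R b = tvec (real_of_int r * real_of_int a1 - real_of_int t * real_of_int b1) (real_of_int r * real_of_int a2 - real_of_int t * real_of_int b2)"
      by (simp add: a_def b_def tvec_def algebra_simps)
    then show ?thesis by (simp only: 1 2)
  qed
  have v: "v = tvec x y"
  proof (cases both_even)
    case True
    have "2 *\<^sub>R v = of_int (2 * \<alpha>) *\<^sub>R a - of_int (2 * \<beta>) *\<^sub>R b"
      by (simp add: v_def scaleR_diff_right)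
    also have "\<dots> = u + (of_int r *\<^sub>R a - of_int t *\<^sub>R b)"
      using True by (simp only: \<alpha>2 \<beta>2 u_def if_True) (simp add: algebra_simps)
    also have "\<dots> = tvec (c - d2) (2 * d2)" by (simp add: u w tvec_add)
    also have "c - d2 = 2 * x" using True \<Delta>g(3) by (simp add: x_def)
    also have "2 * d2 = 2 * y" using True \<Delta>g(3) by (simp add: y_def)
    also have "tvec (2 * x) (2 * y) = 2 *\<^sub>R tvec x y" by (simp add: tvec_def scaleR_add_right)
    finally show ?thesis by simp
  next
    case False
    then show ?thesis using w by (simp add: v_def \<alpha>_def \<beta>_def x_def y_def)
  qed
  have uv: "u \<in> \<Lambda>" "v \<in> \<Lambda>"
    using latI[of p a "- q" b] latI[of \<alpha> a "- \<beta>" b] by (simp_all add: u_def v_def \<Lambda>_def)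
  have M: "M = (+) ` K"
    using trans_group_eq(1)[OF car[OF uv(1)] car[OF uv(2)]] by (simp add: Mtv Klat u v)
  have torM: "toroidal M"
  proof -
    have "c \<noteq> 0" "d2 \<noteq> 0" using \<Delta>g(1,2) assms(2) by auto
    then have "c * y - 0 * x \<noteq> 0" using \<Delta>g(3) by (simp add: y_def)
    then show ?thesis
      unfolding Mtv using car[OF uv(1)] car[OF uv(2)] by (intro toroidal_trans_group) (simp_all add: u v)
  qed
  have "minimal_almost_regular_cover G H \<longleftrightarrow> H = M" for H
    using minimal_cover_unique[of \<Lambda> H] torG torM by (simp add: G M K_def)
  moreover have "num_regions G M = nat \<bar>N\<bar>"
    unfolding G M K \<Lambda>_def by (rule num_regions_height[OF a_nth(2) b_nth(2) scale(2) cop(1) N0])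
  moreover have "real (nat \<bar>N\<bar>) = (if both_even then \<bar>of_int \<Delta> / of_int (g1 * g2)\<bar>
            else 2 * \<bar>of_int \<Delta> / of_int (g1 * g2)\<bar>)"
  proof -
    have "2 * real_of_int \<Delta> = of_int (g1 * g2) * of_int D"
      using arg_cong[OF gD, of real_of_int] by simp
    then have D\<Delta>: "real_of_int D = 2 * (of_int \<Delta> / of_int (g1 * g2))" using g by (simp add: field_simps)
    have "2 * real_of_int N = (if both_even then of_int D else 2 * of_int D)"
      using arg_cong[OF N2, of real_of_int] by (simp split: if_splits)
    then have "real_of_int N = (if both_even then of_int \<Delta> / of_int (g1 * g2)
        else 2 * (of_int \<Delta> / of_int (g1 * g2)))"
      unfolding D\<Delta> by (simp split: if_splits)
    then show ?thesis by (simp add: abs_mult)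
  qed
  ultimately show ?thesis by simp
qed

end
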